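(* Let $\Omega_0\subset\Omega\subset\mathbb{C}$ with $\Omega_0$ closed and $\Omega$ open, let $f$ be analytic on $\Omega\setminus\Omega_0$, and let $z_1,z_2\in\Omega_0$ with $z_1\neq z_2$. Let $\Gamma_1$ and $\Gamma_2$ denote simple closed loops contained in $\Omega\setminus\Omega_0$, with interiors contained in $\Omega$, which encircle $\Omega_0$ (in particular $z_1$ and $z_2$) in the counterclockwise direction. For $n=0,1,2,\dots$ put $$b_n(z_1,z_2)=\frac{1}{2\pi i(z_2-z_1)}\int_{\Gamma_1}\frac{f(w)\,dw}{(w-z_1)^n(w-z_2)^{n+1}},\qquad c_n(z_1,z_2)=\frac{1}{2\pi i(z_2-z_1)}\int_{\Gamma_2}(w-z_1)^{n+1}(w-z_2)^nf(w)\,dw,$$ and let $b_n(z_2,z_1)$, $c_n(z_2,z_1)$ be obtained from these formulas by interchanging $z_1$ and $z_2$ (with the same contours). Then, for any $z\in\Omega\setminus\Omega_0$, $f$ admits the two-point Laurent expansion, for $N=1,2,3,\dots$, $$f(z)=\sum_{n=0}^{N-1}\left[b_n(z_1,z_2)(z-z_1)+b_n(z_2,z_1)(z-z_2)\right](z-z_1)^n(z-z_2)^n$$ $$\qquad+\sum_{n=0}^{N-1}\left[c_n(z_1,z_2)(z-z_1)+c_n(z_2,z_1)(z-z_2)\right](z-z_1)^{-n-1}(z-z_2)^{-n-1}+r_N(z_1,z_2;z),$$ where $$r_N(z_1,z_2;z)=\frac{1}{2\pi i}\int_{\Gamma_1}\frac{f(w)\,dw}{(w-z_1)^N(w-z_2)^N(w-z)}(z-z_1)^N(z-z_2)^N-\frac{1}{2\pi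 i}\int_{\Gamma_2}\frac{(w-z_1)^N(w-z_2)^Nf(w)\,dw}{w-z}\,\frac{1}{(z-z_1)^N(z-z_2)^N},$$ and where in the formula for $r_N$ the loops are such that $\Gamma_2$ does not contain $z$ inside (or on it), whereas $\Gamma_1$ encircles $\Gamma_2$ and the point $z$. Moreover, the expansion is convergent (that is, $r_N(z_1,z_2;z)\to0$ as $N\to\infty$, so that $f(z)$ is the sum of the two corresponding infinite series) for every $z$ in the Cassini annulus $$A_{z_1,z_2}=\{z\in\Omega\setminus\Omega_0:\ r_2<|(z-z_1)(z-z_2)|<r_1\},$$ where $$r_1=\inf_{w\in\mathbb{C}\setminus\Omega}|(w-z_1)(w-z_2)|,\qquad r_2=\sup_{w\in\Omega_0}|(w-z_1)(w-z_2)|.$$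
   Context: A simple closed loop is a (piecewise smooth) simple closed curve; it encircles a set if the set lies in its interior. The infimum of the empty set is $+\infty$. The contour integrals are understood for any contours of the described kind; the coefficients do not depend on the choice of such contours. *)

theory Defs
  imports "HOL-Complex_Analysis.Complex_Analysis"
begin

text \<open>
  By the Jordan curve theorem, \<open>inside (path_image \<gamma>)\<close> is the interior of a simple closed curve;
  the winding number is constantly 1 or constantly -1 there, and the value 1 means that the curve
  is traversed counterclockwise.
\<close>

definition ccw_simple_loop :: "(real \<Rightarrow> complex) \<Rightarrow> bool" where
  "ccw_simple_loop \<gamma> \<longleftrightarrow>
     valid_path \<gamma> \<and> simple_path \<gamma> \<and> pathfinish \<gamma> = pathstart \<gamma> \<and>
     (\<forall>z \<in> inside (path_image \<gamma>). winding_number \<gamma> z = 1)"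

definition admissible_loop :: "complex set \<Rightarrow> complex set \<Rightarrow> (real \<Rightarrow> complex) \<Rightarrow> bool" where
  "admissible_loop \<Omega> \<Omega>\<^sub>0 \<gamma> \<longleftrightarrow>
     ccw_simple_loop \<gamma> \<and> path_image \<gamma> \<subseteq> \<Omega> - \<Omega>\<^sub>0 \<and>
     inside (path_image \<gamma>) \<subseteq> \<Omega> \<and> \<Omega>\<^sub>0 \<subseteq> inside (path_image \<gamma>)"

definition remainder_loops ::
  "complex set \<Rightarrow> complex set \<Rightarrow> complex \<Rightarrow> (real \<Rightarrow> complex) \<Rightarrow> (real \<Rightarrow> complex) \<Rightarrow> bool" where
  "remainder_loops \<Omega> \<Omega>\<^sub>0 z \<Gamma>1 \<Gamma>2 \<longleftrightarrow>
     admissible_loop \<Omega> \<Omega>\<^sub>0 \<Gamma>1 \<and> admissible_loop \<Omega> \<Omega>\<^sub>0 \<Gamma>2 \<and>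
     z \<notin> path_image \<Gamma>2 \<union> inside (path_image \<Gamma>2) \<and>
     path_image \<Gamma>2 \<subseteq> inside (path_image \<Gamma>1) \<and> z \<in> inside (path_image \<Gamma>1)"

definition coeff_b ::
  "(complex \<Rightarrow> complex) \<Rightarrow> (real \<Rightarrow> complex) \<Rightarrow> nat \<Rightarrow> complex \<Rightarrow> complex \<Rightarrow> complex" where
  "coeff_b f \<Gamma> n z1 z2 =
     1 / (2 * of_real pi * \<i> * (z2 - z1)) *
     contour_integral \<Gamma> (\<lambda>w. f w / ((w - z1) ^ n * (w - z2) ^ (n + 1)))"

definition coeff_c ::
  "(complex \<Rightarrow> complex) \<Rightarrow> (real \<Rightarrow> complex) \<Rightarrow> nat \<Rightarrow> complex \<Rightarrow> complex \<Rightarrow> complex" where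
  "coeff_c f \<Gamma> n z1 z2 =
     1 / (2 * of_real pi * \<i> * (z2 - z1)) *
     contour_integral \<Gamma> (\<lambda>w. (w - z1) ^ (n + 1) * (w - z2) ^ n * f w)"

definition regular_term ::
  "(complex \<Rightarrow> complex) \<Rightarrow> (real \<Rightarrow> complex) \<Rightarrow> complex \<Rightarrow> complex \<Rightarrow> complex \<Rightarrow> nat \<Rightarrow> complex" where
  "regular_term f \<Gamma> z1 z2 z n =
     (coeff_b f \<Gamma> n z1 z2 * (z - z1) + coeff_b f \<Gamma> n z2 z1 * (z - z2)) *
     (z - z1) ^ n * (z - z2) ^ n"

definition singular_term ::
  "(complex \<Rightarrow> complex) \<Rightarrow> (real \<Rightarrow> complex) \<Rightarrow> complex \<Rightarrow> complex \<Rightarrow> complex \<Rightarrow> nat \<Rightarrow> complex" where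
  "singular_term f \<Gamma> z1 z2 z n =
     (coeff_c f \<Gamma> n z1 z2 * (z - z1) + coeff_c f \<Gamma> n z2 z1 * (z - z2)) *
     (z - z1) powi (- int n - 1) * (z - z2) powi (- int n - 1)"

definition remainder ::
  "(complex \<Rightarrow> complex) \<Rightarrow> (real \<Rightarrow> complex) \<Rightarrow> (real \<Rightarrow> complex) \<Rightarrow>
   nat \<Rightarrow> complex \<Rightarrow> complex \<Rightarrow> complex \<Rightarrow> complex" where
  "remainder f \<Gamma>1 \<Gamma>2 N z1 z2 z =
     1 / (2 * of_real pi * \<i>) *
       contour_integral \<Gamma>1 (\<lambda>w. f w / ((w - z1) ^ N * (w - z2) ^ N * (w - z))) *
       (z - z1) ^ N * (z - z2) ^ N
   - 1 / (2 * of_real pi * \<i>) *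
       contour_integral \<Gamma>2 (\<lambda>w. (w - z1) ^ N * (w - z2) ^ N * f w / (w - z)) *
       (1 / ((z - z1) ^ N * (z - z2) ^ N))"

text \<open>
  The radii are extended reals, so that the infimum over the empty set (the case
  \<open>\<Omega> = UNIV\<close>) is \<open>\<infinity>\<close>.
\<close>

definition outer_radius :: "complex set \<Rightarrow> complex \<Rightarrow> complex \<Rightarrow> ereal" where
  "outer_radius \<Omega> z1 z2 = (INF w \<in> UNIV - \<Omega>. ereal (cmod ((w - z1) * (w - z2))))"

definition inner_radius :: "complex set \<Rightarrow> complex \<Rightarrow> complex \<Rightarrow> ereal" where
  "inner_radius \<Omega>\<^sub>0 z1 z2 = (SUP w \<in> \<Omega>\<^sub>0. ereal (cmod ((w - z1) * (w - z2))))"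

definition cassini_annulus ::
  "complex set \<Rightarrow> complex set \<Rightarrow> complex \<Rightarrow> complex \<Rightarrow> complex set" where
  "cassini_annulus \<Omega> \<Omega>\<^sub>0 z1 z2 =
     {z \<in> \<Omega> - \<Omega>\<^sub>0. inner_radius \<Omega>\<^sub>0 z1 z2 < ereal (cmod ((z - z1) * (z - z2))) \<and>
                   ereal (cmod ((z - z1) * (z - z2))) < outer_radius \<Omega> z1 z2}"

end

theory Submission
  imports Defs
begin

text \<open>
  Write \<open>P w = (w - z1) * (w - z2)\<close> and let \<open>w' = z1 + z2 - w\<close> be the other point with the same value
  of \<open>P\<close>, so that \<open>P w - P z = (w - z) * (w - z')\<close>. Partial fractions combine the two coefficients of each
  degree into one integral: up to the factor \<open>1 / (2 * pi * i)\<close>, the regular term of degree \<open>n\<close> is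
  \<open>P z ^ n\<close> times the integral of \<open>f w * (w - z') / P w ^ (n + 1)\<close>, and the singular term is
  \<open>1 / P z ^ (n + 1)\<close> times the integral of \<open>f w * (w - z') * P w ^ n\<close>.

  The finite expansion is then Cauchy's formula for the cycle \<open>\<Gamma>1 - \<Gamma>2\<close>, with the kernel
  \<open>1 / (w - z) = (w - z') / (P w - P z)\<close> expanded into a finite geometric series in \<open>P z / P w\<close> on
  \<open>\<Gamma>1\<close> and in \<open>P w / P z\<close> on \<open>\<Gamma>2\<close> (lemmas \<open>remainder_0\<close>, \<open>remainder_Suc\<close>).

  The independence of the loops and the convergence both rest on a Laurent splitting \<open>f = f1 + f2\<close>
  (lemma \<open>laurent_splitting\<close>), where \<open>f1\<close> is holomorphic on \<open>\<Omega>\<close> and \<open>f2\<close> is holomorphic off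
  \<open>\<Omega>\<^sub>0\<close>. Inside an admissible loop \<open>f1\<close> is the Cauchy integral of \<open>f\<close>, outside it \<open>f2\<close> is minus
  that integral, and Dixon's averaged difference quotient, which is holomorphic across the loop, glues
  the pieces together. The integral of \<open>f1\<close> along an admissible loop vanishes, and the integral of
  \<open>f2\<close> is the same for all such loops, since they can be joined to each other far away from
  \<open>\<Omega>\<^sub>0\<close> (lemma \<open>admissible_loops_contour_integral_eq\<close>).

  For the convergence, the obvious contours \<open>\<bar>P w\<bar> = const\<close> are avoided, since these Cassini ovals may be
  connected or not, and may lie inside the given loop, outside it, or across it. Instead, for a
  parameter \<open>p\<close>, the function \<open>(f1 a * (a - p) - f1 a' * (a' - p)) / (a - a')\<close> is invariant
  under \<open>a \<mapsto> a'\<close> and hence equals \<open>g (P a)\<close> for a function \<open>g\<close> that is holomorphic on every disc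
  of radius less than \<open>r1\<close> (lemma \<open>antisymmetrization_descends\<close>). Near \<open>0\<close>, where both roots \<open>a\<close>, \<open>a'\<close>
  are inside the loop, \<open>f1\<close> is the Cauchy integral of \<open>f\<close>, and partial fractions show that \<open>g u\<close> is
  \<open>1 / (2 * pi * i)\<close> times the integral of \<open>f w * (w - p) / (P w - u)\<close>. Its \<open>n\<close>-th Taylor
  coefficient is therefore the factor of \<open>P z ^ n\<close> in the regular term of degree \<open>n\<close>, with \<open>p\<close> in place of
  \<open>z'\<close>. As \<open>g\<close> is holomorphic on the disc, this Taylor series converges on all of it. The choice \<open>p = z'\<close> kills the second summand at
  \<open>a = z\<close>, so that the regular series sums to \<open>g (P z) = f1 z\<close>. The singular series is treated in the
  same way with \<open>f2\<close>, in the variable \<open>1 / P z\<close>, on the disc of radius \<open>1 / r2\<close>.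
\<close>

section \<open>Cauchy transforms of closed paths\<close>

text \<open>
  A translation by a small vector moves the loop off \<open>z0\<close>, provided that the loop does not fill a
  neighbourhood of \<open>z0\<close>; polynomials are dense, and loops that are uniformly close have the same
  integrals. Polynomial loops have a bounded derivative, which a valid path need not have near its
  break points and which differentiation under the integral requires.
\<close>

lemma polynomial_loop_avoiding_point:
  assumes "open S" "valid_path \<gamma>" "pathfinish \<gamma> = pathstart \<gamma>" "path_image \<gamma> \<subseteq> S"
    and "z0 \<notin> interior (path_image \<gamma>)"
  obtains p where "polynomial_function p" "pathfinish p = pathstart p"
    "path_image p \<subseteq> S - {z0}"
    "\<forall>h. h holomorphic_on S \<longrightarrow> contour_integral \<gamma> h = contour_integral p h"
proof -
  have "path \<gamma>"
    using assms valid_path_imp_path by blast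
  obtain d where "d > 0" and d: "\<forall>g h. valid_path g \<and> valid_path h \<and>
      (\<forall>t\<in>{0..1}. norm (g t - \<gamma> t) < d \<and> norm (h t - \<gamma> t) < d) \<and>
      pathfinish g = pathstart g \<and> pathfinish h = pathstart h \<longrightarrow>
      path_image g \<subseteq> S \<and> path_image h \<subseteq> S \<and>
      (\<forall>f. f holomorphic_on S \<longrightarrow> contour_integral h f = contour_integral g f)"
    using contour_integral_nearby_loops[OF assms(1) \<open>path \<gamma>\<close> assms(4)]
    by (elim exE conjE) (rule that)
  have "\<not> ball z0 (d/2) \<subseteq> path_image \<gamma>"
    using assms(5) \<open>d > 0\<close> by (meson half_gt_zero mem_interior)
  then obtain y where y: "y \<notin> path_image \<gamma>" "dist z0 y < d/2"
    unfolding subset_iff mem_ball by blast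
  \<comment> \<open>The translation takes \<open>y\<close>, which is off the path, to \<open>z0\<close>.\<close>
  define \<eta> where "\<eta> = (+) (z0 - y) \<circ> \<gamma>"
  have "path \<eta>"
    unfolding \<eta>_def using \<open>path \<gamma>\<close> by (simp add: path_translation_eq)
  have "z0 \<notin> path_image \<eta>"
    using y(1) by (auto simp: \<eta>_def path_image_def algebra_simps)
  moreover have "closed (path_image \<eta>)"
    using \<open>path \<eta>\<close> by (simp add: closed_path_image)
  ultimately obtain e where "e > 0" and e: "\<And>w. w \<in> path_image \<eta> \<Longrightarrow> e \<le> dist z0 w"
    using separate_point_closed by metis
  obtain p where p: "polynomial_function p" "pathstart p = pathstart \<eta>"
      "pathfinish p = pathfinish \<eta>" "\<And>t. t \<in> {0..1} \<Longrightarrow> norm (p t - \<eta> t) < min e (d/2)"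
    using path_approx_polynomial_function[OF \<open>path \<eta>\<close>, of "min e (d/2)"] \<open>e > 0\<close> \<open>d > 0\<close>
    by auto
  have loop: "pathfinish p = pathstart p"
    using p assms(3) by (simp add: \<eta>_def pathfinish_def pathstart_def)
  have near: "norm (p t - \<gamma> t) < d" if "t \<in> {0..1}" for t
  proof -
    have "norm (\<eta> t - \<gamma> t) < d/2"
      using y(2) by (simp add: \<eta>_def dist_norm)
    moreover have "norm (p t - \<eta> t) < d/2"
      using p(4)[OF that] by simp
    ultimately show ?thesis
      using norm_triangle_lt[of "p t - \<eta> t" "\<eta> t - \<gamma> t" d] by simp
  qed
  have "z0 \<notin> path_image p"
  proof
    assume "z0 \<in> path_image p"
    then obtain t where t: "t \<in> {0..1}" "z0 = p t"
      by (auto simp: path_image_def)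
    then have "norm (p t - \<eta> t) < e"
      using p(4)[OF t(1)] by simp
    moreover have "e \<le> dist (p t) (\<eta> t)"
      using e[of "\<eta> t"] t by (auto simp: path_image_def)
    ultimately show False
      by (simp add: dist_norm)
  qed
  moreover have "path_image p \<subseteq> S \<and>
      (\<forall>f. f holomorphic_on S \<longrightarrow> contour_integral p f = contour_integral \<gamma> f)"
    using d[rule_format, of \<gamma> p] p(1) near loop \<open>d > 0\<close> assms(2,3)
    by (simp add: valid_path_polynomial_function)
  ultimately show ?thesis
    using that[of p] p(1) loop by auto
qed

lemma polynomial_path_Cauchy_transform_holomorphic:
  assumes "polynomial_function p" and hol: "f holomorphic_on S" "open S" "path_image p \<subseteq> S"
  shows "(\<lambda>z. contour_integral p (\<lambda>w. f w / (w - z))) holomorphic_on - path_image p"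
proof -
  have vp: "valid_path p"
    using assms valid_path_polynomial_function by blast
  obtain p' where p': "polynomial_function p'" "\<And>x. (p has_vector_derivative p' x) (at x)"
    using has_vector_derivative_polynomial_function[OF assms(1)] by blast
  have "compact (p' ` {0..1})"
    by (intro compact_continuous_image continuous_on_polymonial_function p') simp
  then obtain B where B: "\<And>x. x \<in> p' ` {0..1} \<Longrightarrow> norm x \<le> B"
    using compact_imp_bounded bounded_iff by metis
  have "norm (vector_derivative p (at t)) \<le> B" if "t \<in> {0..1}" for t
    using B[of "p' t"] that vector_derivative_at[OF p'(2)] by simp
  moreover have "((\<lambda>u. f u / (u - w) ^ 1) has_contour_integral
      contour_integral p (\<lambda>u. f u / (u - w))) p" if "w \<in> UNIV - path_image p" for w
  proof -
    have "(\<lambda>u. f u / (u - w)) contour_integrable_on p"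
      using that hol vp closed_valid_path_image[OF vp]
      by (intro contour_integrable_holomorphic_simple[where S = "S - {w}"] holomorphic_intros)
        (auto intro: holomorphic_on_subset)
    then show ?thesis
      by (simp add: has_contour_integral_integral)
  qed
  moreover have cont: "continuous_on (path_image p) f"
    using hol holomorphic_on_imp_continuous_on continuous_on_subset by blast
  ultimately have "((\<lambda>z. contour_integral p (\<lambda>u. f u / (u - z))) has_field_derivative
      (of_nat 1 * contour_integral p (\<lambda>u. f u / (u - w) ^ Suc 1))) (at w)"
    if "w \<in> - path_image p" for w
    using that vp cont by (intro Cauchy_next_derivative(2)[where S = UNIV and B = B]) auto
  then show ?thesis
    by (auto simp: holomorphic_on_open closed_valid_path_image[OF vp] open_Compl)
qed

definition cauchy_transform :: "(real \<Rightarrow> complex) \<Rightarrow> (complex \<Rightarrow> complex) \<Rightarrow> complex \<Rightarrow> complex" where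
  "cauchy_transform \<gamma> f z = 1 / (2 * of_real pi * \<i>) * contour_integral \<gamma> (\<lambda>w. f w / (w - z))"

text \<open>
  The value on the diagonal removes the singularity, so that the quotient is holomorphic in \<open>w\<close>.
\<close>

definition difference_quotient :: "(complex \<Rightarrow> complex) \<Rightarrow> complex \<Rightarrow> complex \<Rightarrow> complex" where
  "difference_quotient f z w = (if w = z then deriv f z else (f w - f z) / (w - z))"

definition dixon_transform :: "(real \<Rightarrow> complex) \<Rightarrow> (complex \<Rightarrow> complex) \<Rightarrow> complex \<Rightarrow> complex" where
  "dixon_transform \<gamma> f z = 1 / (2 * of_real pi * \<i>) * contour_integral \<gamma> (difference_quotient f z)"

lemma difference_quotient_holomorphic:
  assumes "f holomorphic_on S" "open S"
  shows "difference_quotient f z holomorphic_on S"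
  using pole_lemma_open[OF assms, of z] by (simp add: difference_quotient_def[abs_def])

lemma cauchy_transform_holomorphic:
  assumes "open S" "f holomorphic_on S" "valid_path \<gamma>" "pathfinish \<gamma> = pathstart \<gamma>" "path_image \<gamma> \<subseteq> S"
  shows "cauchy_transform \<gamma> f holomorphic_on - path_image \<gamma>"
proof -
  have op: "open (- path_image \<gamma>)"
    using assms by (simp add: closed_valid_path_image open_Compl)
  have "cauchy_transform \<gamma> f field_differentiable at z0" if z0: "z0 \<in> - path_image \<gamma>" for z0
  proof -
    obtain \<epsilon> where \<epsilon>: "\<epsilon> > 0" "cball z0 \<epsilon> \<subseteq> - path_image \<gamma>"
      using op z0 open_contains_cball by blast
    have S': "open (S - cball z0 \<epsilon>)" "path_image \<gamma> \<subseteq> S - cball z0 \<epsilon>"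
      using assms \<epsilon> by auto
    have "z0 \<notin> interior (path_image \<gamma>)"
      using z0 interior_subset by blast
    then obtain p where p: "polynomial_function p" "pathfinish p = pathstart p"
      "path_image p \<subseteq> S - cball z0 \<epsilon> - {z0}"
      "\<forall>h. h holomorphic_on S - cball z0 \<epsilon> \<longrightarrow> contour_integral \<gamma> h = contour_integral p h"
      by (rule polynomial_loop_avoiding_point[OF S'(1) assms(3,4) S'(2)])
    have "(\<lambda>z. contour_integral p (\<lambda>w. f w / (w - z))) holomorphic_on ball z0 \<epsilon>"
      by (rule holomorphic_on_subset[OF polynomial_path_Cauchy_transform_holomorphic
            [OF p(1) assms(2,1)]]) (use p(3) in force)+
    then have "(\<lambda>z. 1 / (2 * of_real pi * \<i>) * contour_integral p (\<lambda>w. f w / (w - z)))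
        holomorphic_on ball z0 \<epsilon>"
      by (intro holomorphic_intros)
    moreover have "cauchy_transform \<gamma> f z = 1 / (2 * of_real pi * \<i>) * contour_integral p (\<lambda>w. f w / (w - z))"
      if "z \<in> ball z0 \<epsilon>" for z
    proof -
      have "(\<lambda>w. f w / (w - z)) holomorphic_on S - cball z0 \<epsilon>"
        using assms(2) that by (intro holomorphic_intros) (auto intro: holomorphic_on_subset)
      then show ?thesis
        by (simp add: cauchy_transform_def p(4))
    qed
    ultimately have "cauchy_transform \<gamma> f holomorphic_on ball z0 \<epsilon>"
      by (metis (no_types, lifting) holomorphic_cong)
    then show ?thesis
      using \<epsilon>(1) by (simp add: holomorphic_on_imp_differentiable_at)
  qed
  then show ?thesis
    using op by (simp add: holomorphic_on_def field_differentiable_at_within)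
qed

lemma contour_integral_difference_quotient:
  assumes "open S" "f holomorphic_on S" "valid_path p" "path_image p \<subseteq> S - {z}"
  shows "contour_integral p (difference_quotient f z) =
    contour_integral p (\<lambda>w. f w / (w - z)) - f z * contour_integral p (\<lambda>w. 1 / (w - z))"
proof -
  have "(\<lambda>w. f w / (w - z)) contour_integrable_on p"
    using assms by (intro contour_integrable_holomorphic_simple[where S = "S - {z}"] holomorphic_intros)
      (auto intro: holomorphic_on_subset)
  moreover have "(\<lambda>w. 1 / (w - z)) contour_integrable_on p"
    using assms by (intro contour_integrable_holomorphic_simple[where S = "S - {z}"] holomorphic_intros)
      auto
  ultimately have "contour_integral p (\<lambda>w. f w / (w - z)) - f z * contour_integral p (\<lambda>w. 1 / (w - z)) =
      contour_integral p (\<lambda>w. f w / (w - z) - f z * (1 / (w - z)))"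
    by (simp add: contour_integral_diff contour_integrable_lmul contour_integral_lmul del: times_divide_eq_right)
  also have "\<dots> = contour_integral p (difference_quotient f z)"
    using assms(4) by (intro contour_integral_cong) (auto simp: difference_quotient_def diff_divide_distrib)
  finally show ?thesis ..
qed

text \<open>
  The Dixon transform is defined on the loop as well, and off the loop it differs from the Cauchy
  transform by the winding number times \<open>f\<close>. It is what continues the Cauchy transform analytically from
  one side of the loop to the other.
\<close>

lemma dixon_transform_eq:
  assumes "open S" "f holomorphic_on S" "valid_path \<gamma>" "path_image \<gamma> \<subseteq> S" "z \<notin> path_image \<gamma>"
  shows "dixon_transform \<gamma> f z = cauchy_transform \<gamma> f z - f z * winding_number \<gamma> z"
proof -
  have "contour_integral \<gamma> (\<lambda>w. 1 / (w - z)) = 2 * of_real pi * \<i> * winding_number \<gamma> z"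
    using winding_number_valid_path[of \<gamma> z] assms by simp
  then show ?thesis
    using contour_integral_difference_quotient[OF assms(1-3), of z] assms(4,5)
    by (simp add: subset_Diff_insert dixon_transform_def cauchy_transform_def field_simps)
qed

text \<open>
  The integrand is holomorphic in \<open>w\<close> on all of \<open>S\<close>, also at \<open>w = z\<close>. Hence, near a given point of
  \<open>S\<close>, the loop may be replaced by one that avoids this point, and there the transform is a combination
  of Cauchy transforms.
\<close>

lemma dixon_transform_holomorphic:
  assumes "open S" "f holomorphic_on S" "valid_path \<gamma>" "pathfinish \<gamma> = pathstart \<gamma>" "path_image \<gamma> \<subseteq> S"
    and "interior (path_image \<gamma>) = {}"
  shows "dixon_transform \<gamma> f holomorphic_on S"
proof -
  have "dixon_transform \<gamma> f field_differentiable at z0" if z0: "z0 \<in> S" for z0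
  proof -
    have "z0 \<notin> interior (path_image \<gamma>)"
      using assms(6) by simp
    then obtain p where p: "polynomial_function p" "pathfinish p = pathstart p"
      "path_image p \<subseteq> S - {z0}"
      "\<forall>h. h holomorphic_on S \<longrightarrow> contour_integral \<gamma> h = contour_integral p h"
      by (rule polynomial_loop_avoiding_point[OF assms(1,3,4,5)])
    have vp: "valid_path p"
      using p(1) valid_path_polynomial_function by blast
    have op: "open (S - path_image p)"
      using assms(1) vp by (simp add: closed_valid_path_image open_Diff)
    have pS: "path_image p \<subseteq> S"
      using p(3) by blast
    have "(\<lambda>z. contour_integral p (\<lambda>w. f w / (w - z))) holomorphic_on S - path_image p"
         "(\<lambda>z. contour_integral p (\<lambda>w. 1 / (w - z))) holomorphic_on S - path_image p"
      by (rule holomorphic_on_subset[OF polynomial_path_Cauchy_transform_holomorphic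
            [OF p(1) _ assms(1) pS]]; use assms(2) in auto)+
    moreover have "f holomorphic_on S - path_image p"
      using assms(2) holomorphic_on_subset by blast
    ultimately have "(\<lambda>z. 1 / (2 * of_real pi * \<i>) * (contour_integral p (\<lambda>w. f w / (w - z)) -
        f z * contour_integral p (\<lambda>w. 1 / (w - z)))) holomorphic_on S - path_image p"
      by (intro holomorphic_intros)
    moreover have "dixon_transform \<gamma> f z = 1 / (2 * of_real pi * \<i>) * (contour_integral p (\<lambda>w. f w / (w - z)) -
        f z * contour_integral p (\<lambda>w. 1 / (w - z)))" if "z \<in> S - path_image p" for z
    proof -
      have "path_image p \<subseteq> S - {z}"
        using pS that by blast
      then show ?thesis
        unfolding dixon_transform_def p(4)[rule_format, OF difference_quotient_holomorphic[OF assms(2,1)]]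
        using contour_integral_difference_quotient[OF assms(1,2) vp] by simp
    qed
    ultimately have "dixon_transform \<gamma> f holomorphic_on S - path_image p"
      by (metis (no_types, lifting) holomorphic_cong)
    then show ?thesis
      using op z0 p(3) holomorphic_on_imp_differentiable_at by blast
  qed
  then show ?thesis
    by (simp add: holomorphic_on_def field_differentiable_at_within)
qed

section \<open>Laurent splitting along an admissible loop\<close>

lemma interior_path_image_simple_loop:
  fixes \<gamma> :: "real \<Rightarrow> complex"
  assumes "simple_path \<gamma>" "pathfinish \<gamma> = pathstart \<gamma>"
  shows "interior (path_image \<gamma>) = {}"
proof -
  have "frontier (inside (path_image \<gamma>)) = path_image \<gamma>"
    using Jordan_inside_outside[OF assms] by blast
  moreover have "interior (path_image \<gamma>) \<inter> inside (path_image \<gamma>) = {}"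
    using interior_subset inside_no_overlap by blast
  ultimately show ?thesis
    using open_Int_closure_eq_empty[OF open_interior] interior_subset frontier_def
    by (metis Diff_subset inf.absorb_iff1 subset_trans)
qed

lemma admissible_loopD:
  assumes "admissible_loop \<Omega> \<Omega>\<^sub>0 \<gamma>"
  shows "valid_path \<gamma>" "simple_path \<gamma>" "pathfinish \<gamma> = pathstart \<gamma>" "path_image \<gamma> \<subseteq> \<Omega> - \<Omega>\<^sub>0"
    "inside (path_image \<gamma>) \<subseteq> \<Omega>" "\<Omega>\<^sub>0 \<subseteq> inside (path_image \<gamma>)"
    "open (inside (path_image \<gamma>))" "open (outside (path_image \<gamma>))"
    "\<And>z. z \<in> inside (path_image \<gamma>) \<Longrightarrow> winding_number \<gamma> z = 1"
    "\<And>z. z \<in> outside (path_image \<gamma>) \<Longrightarrow> winding_number \<gamma> z = 0"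
    "outside (path_image \<gamma>) = - (inside (path_image \<gamma>) \<union> path_image \<gamma>)"
    "compact (inside (path_image \<gamma>) \<union> path_image \<gamma>)"
proof -
  have *: "valid_path \<gamma>" "simple_path \<gamma>" "pathfinish \<gamma> = pathstart \<gamma>"
    using assms by (auto simp: admissible_loop_def ccw_simple_loop_def)
  note J = Jordan_inside_outside[OF *(2,3)]
  show "outside (path_image \<gamma>) = - (inside (path_image \<gamma>) \<union> path_image \<gamma>)"
    using union_with_outside[of "path_image \<gamma>"] union_with_inside[of "path_image \<gamma>"] J by blast
  have "inside (path_image \<gamma>) \<union> path_image \<gamma> = closure (inside (path_image \<gamma>))"
    using J closure_Un_frontier[of "inside (path_image \<gamma>)"] by simp
  then show "compact (inside (path_image \<gamma>) \<union> path_image \<gamma>)"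
    using J by (simp add: compact_closure)
  show "winding_number \<gamma> z = 0" if "z \<in> outside (path_image \<gamma>)" for z
    using * that by (simp add: winding_number_zero_in_outside valid_path_imp_path)
qed (use assms Jordan_inside_outside in \<open>auto simp: admissible_loop_def ccw_simple_loop_def\<close>)

text \<open>
  With \<open>C\<close> the Cauchy transform and \<open>D\<close> the Dixon transform, the summands are \<open>f + D\<close> and
  \<open>- D\<close> on \<open>\<Omega> - \<Omega>\<^sub>0\<close>. As \<open>D = C - f\<close> inside the loop and \<open>D = C\<close> outside, the
  first continues by \<open>C\<close> to the whole interior, which contains \<open>\<Omega>\<^sub>0\<close>, and the second by \<open>- C\<close> to the
  whole exterior, which contains the complement of \<open>\<Omega>\<close>.
\<close>

lemma laurent_splitting:
  assumes "open \<Omega>" "closed \<Omega>\<^sub>0" "f holomorphic_on \<Omega> - \<Omega>\<^sub>0" "admissible_loop \<Omega> \<Omega>\<^sub>0 \<gamma>"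
  obtains f1 f2 where "f1 holomorphic_on \<Omega>" "f2 holomorphic_on - \<Omega>\<^sub>0"
    "\<And>z. z \<in> \<Omega> - \<Omega>\<^sub>0 \<Longrightarrow> f z = f1 z + f2 z"
    "\<And>z. z \<in> inside (path_image \<gamma>) \<Longrightarrow> f1 z = cauchy_transform \<gamma> f z"
    "\<And>z. z \<in> outside (path_image \<gamma>) \<Longrightarrow> f2 z = - cauchy_transform \<gamma> f z"
proof -
  define U where "U = \<Omega> - \<Omega>\<^sub>0"
  define C where "C = cauchy_transform \<gamma> f"
  define D where "D = dixon_transform \<gamma> f"
  define f1 where "f1 = (\<lambda>z. if z \<in> U then f z + D z else C z)"
  define f2 where "f2 = (\<lambda>z. if z \<in> U then - D z else - C z)"
  note \<gamma> = admissible_loopD[OF assms(4)]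
  have U: "open U" "f holomorphic_on U" "path_image \<gamma> \<subseteq> U"
    using assms \<gamma> by (auto simp: U_def)
  have "D holomorphic_on U"
    unfolding D_def using U \<gamma> interior_path_image_simple_loop[of \<gamma>]
    by (intro dixon_transform_holomorphic) auto
  moreover have "C holomorphic_on - path_image \<gamma>"
    unfolding C_def using U \<gamma> by (intro cauchy_transform_holomorphic[of U])
  then have "C holomorphic_on inside (path_image \<gamma>)" "C holomorphic_on outside (path_image \<gamma>)"
    by (rule holomorphic_on_subset; use inside_no_overlap outside_no_overlap in blast)+
  moreover have DC: "D z = C z - f z * winding_number \<gamma> z" if "z \<in> U" "z \<notin> path_image \<gamma>" for z
    unfolding D_def C_def using U \<gamma> that by (intro dixon_transform_eq) auto
  have off: "z \<notin> path_image \<gamma>" if "z \<in> inside (path_image \<gamma>) \<or> z \<in> outside (path_image \<gamma>)" for z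
    using that inside_no_overlap outside_no_overlap by blast
  have in1: "f1 z = C z" if "z \<in> inside (path_image \<gamma>)" for z
    using DC[of z] \<gamma>(9)[OF that] that off[of z]
    by (auto simp: f1_def)
  have out2: "f2 z = - C z" if "z \<in> outside (path_image \<gamma>)" for z
    using DC[of z] \<gamma>(10)[OF that] that off[of z]
    by (auto simp: f2_def)
  have "f1 holomorphic_on U \<union> inside (path_image \<gamma>)"
  proof (rule holomorphic_on_Un)
    have "(\<lambda>z. f z + D z) holomorphic_on U"
      using U(2) \<open>D holomorphic_on U\<close> by (intro holomorphic_intros)
    then show "f1 holomorphic_on U"
      by (rule holomorphic_transform) (simp add: f1_def)
    show "f1 holomorphic_on inside (path_image \<gamma>)"
      using \<open>C holomorphic_on inside (path_image \<gamma>)\<close> by (rule holomorphic_transform) (simp add: in1)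
  qed (use U \<gamma> in auto)
  moreover have "f2 holomorphic_on U \<union> outside (path_image \<gamma>)"
  proof (rule holomorphic_on_Un)
    have "(\<lambda>z. - D z) holomorphic_on U"
      using \<open>D holomorphic_on U\<close> by (intro holomorphic_intros)
    then show "f2 holomorphic_on U"
      by (rule holomorphic_transform) (simp add: f2_def)
    have "(\<lambda>z. - C z) holomorphic_on outside (path_image \<gamma>)"
      using \<open>C holomorphic_on outside (path_image \<gamma>)\<close> by (intro holomorphic_intros)
    then show "f2 holomorphic_on outside (path_image \<gamma>)"
      by (rule holomorphic_transform) (simp add: out2)
  qed (use U \<gamma> in auto)
  moreover have "U \<union> inside (path_image \<gamma>) = \<Omega>"
    using \<gamma> by (auto simp: U_def)
  moreover have "U \<union> outside (path_image \<gamma>) = - \<Omega>\<^sub>0"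
    using \<gamma> by (auto simp: U_def)
  ultimately show ?thesis
    using that[of f1 f2] in1 out2 by (simp add: C_def f1_def f2_def U_def)
qed

section \<open>Independence of the admissible loop\<close>

text \<open>
  A path in \<open>S\<close> that joins the two loops turns their difference into a single closed path, to which
  the homology form of Cauchy's theorem applies.
\<close>

lemma contour_integral_eq_linked_loops:
  assumes "open S" "h holomorphic_on S"
    and \<gamma>: "valid_path \<gamma>" "pathfinish \<gamma> = pathstart \<gamma>" "path_image \<gamma> \<subseteq> S"
    and \<eta>: "valid_path \<eta>" "pathfinish \<eta> = pathstart \<eta>" "path_image \<eta> \<subseteq> S"
    and link: "connected_component S (pathstart \<gamma>) (pathstart \<eta>)"
    and wn: "\<And>z. z \<notin> S \<Longrightarrow> winding_number \<gamma> z = winding_number \<eta> z"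
  shows "contour_integral \<gamma> h = contour_integral \<eta> h"
proof -
  define K where "K = connected_component_set S (pathstart \<gamma>)"
  have "open K" "connected K" "pathstart \<gamma> \<in> K" "pathstart \<eta> \<in> K"
    using assms link by (auto simp: K_def open_connected_component)
  then obtain p where p: "polynomial_function p" "path_image p \<subseteq> K"
      "pathstart p = pathstart \<gamma>" "pathfinish p = pathstart \<eta>"
    using connected_open_polynomial_connected by metis
  have vp: "valid_path p" and pS: "path_image p \<subseteq> S"
    using p valid_path_polynomial_function connected_component_subset[of S] by (auto simp: K_def)
  have pth: "path \<gamma>" "path \<eta>" "path p"
    using \<gamma> \<eta> vp valid_path_imp_path by auto
  have int: "h contour_integrable_on g" if "valid_path g" "path_image g \<subseteq> S" for g
    using assms(1,2) that contour_integrable_holomorphic_simple by blast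
  define c where "c = \<gamma> +++ p +++ reversepath \<eta> +++ reversepath p"
  have c: "valid_path c" "pathfinish c = pathstart c" "path_image c \<subseteq> S"
    using \<gamma> \<eta> vp pS p(3,4) by (auto simp: c_def path_image_join)
  have "(h has_contour_integral 0) c"
  proof (rule Cauchy_theorem_global[OF assms(1,2) c])
    fix z assume z: "z \<notin> S"
    then have "z \<notin> path_image \<gamma>" "z \<notin> path_image \<eta>" "z \<notin> path_image p"
      using \<gamma> \<eta> pS by auto
    then have "winding_number c z = winding_number \<gamma> z - winding_number \<eta> z"
      using pth \<gamma>(2) \<eta>(2) p(3,4)
      by (simp add: c_def winding_number_join winding_number_reversepath path_image_join)
    then show "winding_number c z = 0"
      using wn[OF z] by simp
  qed
  moreover have "contour_integral c h = contour_integral \<gamma> h - contour_integral \<eta> h"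
    using \<gamma> \<eta> vp pS p(3,4) int
    by (simp add: c_def contour_integral_reversepath path_image_join)
  ultimately show ?thesis
    by (simp add: contour_integral_unique)
qed

text \<open>
  Only the part that is holomorphic off \<open>\<Omega>\<^sub>0\<close> contributes to the integral. For this part the two
  loops may be linked outside \<open>\<Omega>\<close>: the closed exteriors of the loops avoid \<open>\<Omega>\<^sub>0\<close>, are connected,
  and meet near infinity.
\<close>

lemma admissible_loops_contour_integral_eq:
  assumes "open \<Omega>" "closed \<Omega>\<^sub>0" "h holomorphic_on \<Omega> - \<Omega>\<^sub>0"
    and "admissible_loop \<Omega> \<Omega>\<^sub>0 \<gamma>" "admissible_loop \<Omega> \<Omega>\<^sub>0 \<eta>"
  shows "contour_integral \<gamma> h = contour_integral \<eta> h"
proof -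
  obtain h1 h2 where h1: "h1 holomorphic_on \<Omega>" and h2: "h2 holomorphic_on - \<Omega>\<^sub>0"
    and h: "\<And>z. z \<in> \<Omega> - \<Omega>\<^sub>0 \<Longrightarrow> h z = h1 z + h2 z"
    using laurent_splitting[OF assms(1-4)] by metis
  have split: "contour_integral c h = contour_integral c h2" if "admissible_loop \<Omega> \<Omega>\<^sub>0 c" for c
  proof -
    note c = admissible_loopD[OF that]
    have "(h1 has_contour_integral 0) c"
    proof (rule Cauchy_theorem_global[OF assms(1) h1])
      show "winding_number c w = 0" if "w \<notin> \<Omega>" for w
        using that c by blast
    qed (use c in auto)
    moreover have "h2 contour_integrable_on c"
      using h2 c assms(2) by (intro contour_integrable_holomorphic_simple[of h2 "- \<Omega>\<^sub>0"]) auto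
    ultimately have "contour_integral c (\<lambda>z. h1 z + h2 z) = contour_integral c h2"
      by (metis add_0 contour_integral_add contour_integral_unique has_contour_integral_integrable)
    moreover have "contour_integral c h = contour_integral c (\<lambda>z. h1 z + h2 z)"
      using h c by (intro contour_integral_cong) auto
    ultimately show ?thesis
      by simp
  qed
  note \<gamma> = admissible_loopD[OF assms(4)]
  note \<eta> = admissible_loopD[OF assms(5)]
  have conn: "connected (closure (outside (path_image c)))"
    "closure (outside (path_image c)) = outside (path_image c) \<union> path_image c"
    "closure (outside (path_image c)) \<subseteq> - \<Omega>\<^sub>0"
    if "admissible_loop \<Omega> \<Omega>\<^sub>0 c" for c
  proof -
    note c = admissible_loopD[OF that]
    note J = Jordan_inside_outside[OF c(2,3)]
    show eq: "closure (outside (path_image c)) = outside (path_image c) \<union> path_image c"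
      using J closure_Un_frontier[of "outside (path_image c)"] by simp
    show "connected (closure (outside (path_image c)))"
      using J connected_imp_connected_closure by blast
    show "closure (outside (path_image c)) \<subseteq> - \<Omega>\<^sub>0"
      unfolding eq using c by blast
  qed
  have "contour_integral \<gamma> h2 = contour_integral \<eta> h2"
  proof (rule contour_integral_eq_linked_loops)
    let ?T = "closure (outside (path_image \<gamma>)) \<union> closure (outside (path_image \<eta>))"
    have "- outside (path_image \<gamma>) \<union> - outside (path_image \<eta>) \<noteq> UNIV"
      using cobounded_outside[of "path_image \<gamma>"] cobounded_outside[of "path_image \<eta>"] \<gamma>(1) \<eta>(1)
      by (metis bounded_Un bounded_valid_path_image not_bounded_UNIV)
    then have "outside (path_image \<gamma>) \<inter> outside (path_image \<eta>) \<noteq> {}"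
      by blast
    then have "closure (outside (path_image \<gamma>)) \<inter> closure (outside (path_image \<eta>)) \<noteq> {}"
      using closure_subset by blast
    then have "connected ?T"
      using conn(1)[OF assms(4)] conn(1)[OF assms(5)] by (rule connected_Un[rotated 2])
    moreover have "?T \<subseteq> - \<Omega>\<^sub>0"
      using conn(3)[OF assms(4)] conn(3)[OF assms(5)] by blast
    moreover have "pathstart \<gamma> \<in> ?T" "pathstart \<eta> \<in> ?T"
      using conn(2)[OF assms(4)] conn(2)[OF assms(5)] by auto
    ultimately show "connected_component (- \<Omega>\<^sub>0) (pathstart \<gamma>) (pathstart \<eta>)"
      unfolding connected_component_def by blast
    show "winding_number \<gamma> z = winding_number \<eta> z" if "z \<notin> - \<Omega>\<^sub>0" for z
      using that \<gamma>(6,9) \<eta>(6,9) by (metis ComplI subsetD)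
  qed (use \<gamma> \<eta> h2 assms in auto)
  then show ?thesis
    using split assms by simp
qed

section \<open>Power series of contour integrals\<close>

text \<open>
  The geometric series is integrated term by term. The integral is bounded by the supremum of the
  integrand over a neighbourhood of the path rather than over the path itself, because a valid path need
  not be rectifiable; a relatively compact neighbourhood bounds \<open>k\<close> and \<open>Q\<close>.
\<close>

lemma contour_integral_power_series_coefficients:
  assumes "open S" "k holomorphic_on S" "Q holomorphic_on S" "valid_path \<gamma>" "path_image \<gamma> \<subseteq> S"
  obtains \<epsilon> where "\<epsilon> > 0"
    "\<And>u. norm u < \<epsilon> \<Longrightarrow> (\<lambda>n. contour_integral \<gamma> (\<lambda>w. k w * Q w ^ n) * u ^ n) sums
       contour_integral \<gamma> (\<lambda>w. k w / (1 - u * Q w))"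
proof -
  have "compact (path_image \<gamma>)"
    using assms compact_valid_path_image by blast
  then obtain e where e: "e > 0" "(\<Union>x\<in>path_image \<gamma>. cball x e) \<subseteq> S"
    using compact_subset_open_imp_cball_epsilon_subset[of "path_image \<gamma>" S] assms by auto
  define T where "T = (\<Union>x\<in>path_image \<gamma>. ball x e)"
  define T' where "T' = (\<Union>x\<in>path_image \<gamma>. cball x e)"
  have T: "open T" "path_image \<gamma> \<subseteq> T" "T \<subseteq> T'" "T' \<subseteq> S"
    using e by (auto simp: T_def T'_def)
  have "T' = {x + y |x y. x \<in> path_image \<gamma> \<and> y \<in> cball 0 e}"
    unfolding T'_def by (auto simp: dist_norm) (metis add.commute diff_add_cancel dist_commute dist_norm)
  then have "compact T'"
    using compact_sums[OF \<open>compact (path_image \<gamma>)\<close> compact_cball, of 0 e] by metis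
  then have "compact (Q ` T')" "compact (k ` T')"
    using assms T by (auto intro!: compact_continuous_image
        continuous_on_subset[OF holomorphic_on_imp_continuous_on])
  then obtain M K where M: "M > 0" "\<And>w. w \<in> T' \<Longrightarrow> norm (Q w) \<le> M"
    and K: "K > 0" "\<And>w. w \<in> T' \<Longrightarrow> norm (k w) \<le> K"
    using compact_imp_bounded bounded_pos by (metis image_eqI)
  obtain L where L: "L > 0" "\<And>f B. f holomorphic_on T \<Longrightarrow> (\<forall>z\<in>T. norm (f z) \<le> B) \<Longrightarrow>
      norm (contour_integral \<gamma> f) \<le> L * B"
    using contour_integral_bound_exists[OF T(1) assms(4) T(2)] by blast
  have hol: "k holomorphic_on T" "Q holomorphic_on T"
    using assms(2,3) T(3,4) by (meson holomorphic_on_subset order_trans)+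
  have integrable: "g contour_integrable_on \<gamma>" if "g holomorphic_on T" for g
    using contour_integrable_holomorphic_simple[OF that T(1) assms(4) T(2)] .
  have "(\<lambda>n. contour_integral \<gamma> (\<lambda>w. k w * Q w ^ n) * u ^ n) sums
       contour_integral \<gamma> (\<lambda>w. k w / (1 - u * Q w))" if u: "norm u < 1 / (2 * M)" for u
  proof -
    have small: "norm (u * Q w) \<le> 1/2" if "w \<in> T" for w
    proof -
      have "norm (u * Q w) \<le> 1 / (2 * M) * M"
        unfolding norm_mult using u M(1) M(2)[of w] that T(3) by (intro mult_mono) auto
      then show ?thesis
        using M(1) by simp
    qed
    have big: "1/2 \<le> norm (1 - u * Q w)" if "w \<in> T" for w
      using norm_triangle_ineq2[of 1 "u * Q w"] small[OF that] by simp
    then have nz: "1 - u * Q w \<noteq> 0" if "w \<in> T" for w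
      using that by fastforce
    define I where "I = (\<lambda>N. contour_integral \<gamma> (\<lambda>w. k w * (u * Q w) ^ N / (1 - u * Q w)))"
    have holI: "(\<lambda>w. k w * (u * Q w) ^ N / (1 - u * Q w)) holomorphic_on T" for N
      using hol nz by (intro holomorphic_intros) auto
    have step: "I N = contour_integral \<gamma> (\<lambda>w. k w * Q w ^ N) * u ^ N + I (Suc N)" for N
    proof -
      have "(\<lambda>w. k w * Q w ^ N) holomorphic_on T"
        using hol by (intro holomorphic_intros)
      then have "contour_integral \<gamma> (\<lambda>w. k w * Q w ^ N * u ^ N) =
          contour_integral \<gamma> (\<lambda>w. k w * Q w ^ N) * u ^ N"
        "(\<lambda>w. k w * Q w ^ N * u ^ N) contour_integrable_on \<gamma>"
        using integrable contour_integral_rmul contour_integrable_rmul by auto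
      then have "contour_integral \<gamma> (\<lambda>w. k w * Q w ^ N) * u ^ N + I (Suc N) =
          contour_integral \<gamma> (\<lambda>w. k w * Q w ^ N * u ^ N + k w * (u * Q w) ^ Suc N / (1 - u * Q w))"
        unfolding I_def using integrable[OF holI] by (simp only: contour_integral_add)
      also have "\<dots> = I N"
        unfolding I_def
      proof (rule contour_integral_cong)
        fix w assume "w \<in> path_image \<gamma>"
        then have "1 - u * Q w \<noteq> 0"
          using T(2) nz by blast
        moreover have "x + x * y / (1 - y) = x / (1 - y)" if "1 - y \<noteq> 0" for x y :: complex
          using that by (simp add: field_simps)
        ultimately have "k w * (u * Q w) ^ N + k w * (u * Q w) ^ N * (u * Q w) / (1 - u * Q w) =
            k w * (u * Q w) ^ N / (1 - u * Q w)"
          by blast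
        then show "k w * Q w ^ N * u ^ N + k w * (u * Q w) ^ Suc N / (1 - u * Q w) =
            k w * (u * Q w) ^ N / (1 - u * Q w)"
          by (simp add: power_mult_distrib mult_ac)
      qed simp
      finally show ?thesis ..
    qed
    have partial: "(\<Sum>n<N. contour_integral \<gamma> (\<lambda>w. k w * Q w ^ n) * u ^ n) = I 0 - I N" for N
    proof (induction N)
      case (Suc N)
      then show ?case
        using step[of N] by simp
    qed simp
    have "norm (I N) \<le> L * (2 * K) * (1/2) ^ N" for N
    proof -
      have "norm (k w * (u * Q w) ^ N / (1 - u * Q w)) \<le> K * (1/2) ^ N / (1/2)" if "w \<in> T" for w
        unfolding norm_divide norm_mult[of "k w"] norm_power
        using K T(3) that small[OF that] big[OF that]
        by (intro frac_le mult_mono power_mono) (auto intro!: mult_nonneg_nonneg)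
      then show ?thesis
        using L(2)[OF holI, of N "K * (1/2) ^ N / (1/2)"] by (simp add: I_def mult_ac)
    qed
    moreover have "(\<lambda>N. L * (2 * K) * (1/2) ^ N) \<longlonglongrightarrow> 0"
      by (intro tendsto_mult_right_zero LIMSEQ_realpow_zero) auto
    ultimately have "I \<longlonglongrightarrow> 0"
      by (intro Lim_null_comparison[of I]) auto
    then have "(\<lambda>N. I 0 - I N) \<longlonglongrightarrow> I 0 - 0"
      by (intro tendsto_intros)
    then show ?thesis
      unfolding sums_def partial by (simp add: I_def)
  qed
  then show ?thesis
    using that[of "1 / (2 * M)"] M(1) by simp
qed

text \<open>
  By uniqueness of power series the \<open>c n\<close> are the Taylor coefficients of \<open>g\<close>, and the Taylor series
  converges on every disc on which \<open>g\<close> is holomorphic. This is how convergence known for small \<open>u\<close>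
  is extended to the whole range of the theorem.
\<close>

lemma power_series_sums_on_ball:
  fixes g :: "complex \<Rightarrow> complex"
  assumes "g holomorphic_on ball 0 R" "\<epsilon> > 0"
    and "\<And>u. norm u < \<epsilon> \<Longrightarrow> (\<lambda>n. c n * u ^ n) sums g u"
    and "norm u < R"
  shows "(\<lambda>n. c n * u ^ n) sums g u"
proof -
  have "eventually (\<lambda>u. u \<in> ball 0 \<epsilon>) (nhds (0 :: complex))"
    using \<open>\<epsilon> > 0\<close> by (intro eventually_nhds_in_open) auto
  then have "g has_fps_expansion Abs_fps c"
    using assms(3) by (intro has_fps_expansionI) (auto elim: eventually_mono)
  then have "c n = (deriv ^^ n) g 0 / fact n" for n
    using fps_nth_fps_expansion[of g "Abs_fps c" n] by simp
  then show ?thesis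
    using holomorphic_power_series[OF assms(1), of u] assms(4) by simp
qed

section \<open>Descent along the quadratic map\<close>

text \<open>
  Evenness makes the choice of the square root irrelevant, so that near every \<open>v0 \<noteq> 0\<close> a branch that is
  holomorphic there can be used; continuity at \<open>0\<close> removes the singularity there.
\<close>

lemma even_function_csqrt_holomorphic:
  assumes "open V" and hol: "\<kappa> holomorphic_on {t. t ^ 2 \<in> V}" and even: "\<And>t. \<kappa> (- t) = \<kappa> t"
  shows "(\<lambda>v. \<kappa> (csqrt v)) holomorphic_on V"
proof (rule no_isolated_singularity')
  have W: "open {t :: complex. t ^ 2 \<in> V}"
    using open_vimage[OF assms(1), of "\<lambda>t::complex. t ^ 2"] by (simp add: vimage_def continuous_intros)
  have "(\<lambda>v. \<kappa> (csqrt v)) field_differentiable at v0" if v0: "v0 \<in> V" "v0 \<noteq> 0" for v0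
  proof -
    \<comment> \<open>The square root with its branch cut rotated away from \<open>v0\<close>.\<close>
    define s where "s = (\<lambda>v. csqrt v0 * csqrt (v / v0))"
    have s2: "s v ^ 2 = v" for v
      using v0 by (simp add: s_def power_mult_distrib)
    have eq: "\<kappa> (csqrt v) = \<kappa> (s v)" for v
      using s2[of v] even[of "s v"] by (metis power2_csqrt power2_eq_iff)
    have "(csqrt \<circ> (\<lambda>v. v / v0)) field_differentiable at v0"
      using v0 by (intro field_differentiable_compose field_differentiable_within_csqrt derivative_intros) auto
    then have "s field_differentiable at v0"
      unfolding s_def o_def by (intro derivative_intros)
    moreover have "\<kappa> field_differentiable at (s v0)"
      using W hol v0 s2[of v0] holomorphic_on_imp_differentiable_at by fastforce
    ultimately have "(\<kappa> \<circ> s) field_differentiable at v0"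
      by (intro field_differentiable_compose)
    then show ?thesis
      by (simp add: eq o_def)
  qed
  then show "(\<lambda>v. \<kappa> (csqrt v)) holomorphic_on V - {0} \<inter> V"
    unfolding holomorphic_on_def using field_differentiable_at_within by blast
  fix v assume "v \<in> {0} \<inter> V"
  then have v: "v = 0" "0 \<in> V"
    by auto
  have "((\<lambda>v. norm (csqrt v)) \<longlongrightarrow> sqrt (norm (0::complex))) (at 0)"
    unfolding norm_csqrt by (intro tendsto_intros)
  then have "((\<lambda>v. norm (csqrt v)) \<longlongrightarrow> 0) (at 0)"
    by (simp only: norm_zero real_sqrt_zero)
  then have "(csqrt \<longlongrightarrow> 0) (at 0)"
    by (rule tendsto_norm_zero_cancel)
  then have "isCont csqrt 0"
    by (simp add: isCont_def)
  moreover have "isCont \<kappa> (csqrt 0)"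
    using W hol v holomorphic_on_imp_differentiable_at[OF hol W]
    by (simp add: field_differentiable_imp_continuous_at)
  ultimately have "isCont (\<lambda>v. \<kappa> (csqrt v)) v"
    using isCont_o2 v by blast
  then show "((\<lambda>v. \<kappa> (csqrt v)) \<longlongrightarrow> \<kappa> (csqrt v)) (at v within V)"
    by (meson isCont_def subset_UNIV tendsto_within_subset)
qed (use assms in auto)

text \<open>
  The level curves of \<open>\<bar>cassini z1 z2 w\<bar>\<close> are the Cassini ovals with foci \<open>z1\<close> and \<open>z2\<close>.
\<close>

definition cassini :: "complex \<Rightarrow> complex \<Rightarrow> complex \<Rightarrow> complex" where
  "cassini z1 z2 w = (w - z1) * (w - z2)"

text \<open>
  The non-trivial deck transformation of the two-sheeted branched covering given by \<open>cassini\<close>.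
\<close>

definition reflect :: "complex \<Rightarrow> complex \<Rightarrow> complex \<Rightarrow> complex" where
  "reflect z1 z2 w = z1 + z2 - w"

lemma cassini_diff: "cassini z1 z2 w - cassini z1 z2 z = (w - z) * (w - reflect z1 z2 z)"
  by (simp add: cassini_def reflect_def algebra_simps)

lemma cassini_reflect [simp]: "cassini z1 z2 (reflect z1 z2 w) = cassini z1 z2 w"
  by (simp add: cassini_def reflect_def algebra_simps)

lemma cassini_holomorphic [holomorphic_intros]: "cassini z1 z2 holomorphic_on S"
  unfolding cassini_def[abs_def] by (intro holomorphic_intros)

text \<open>
  The excluded value is the critical value of \<open>cassini\<close>, attained at the midpoint of the foci.
\<close>

lemma cassini_root:
  assumes "u \<noteq> - (((z2 - z1) / 2) ^ 2)"
  obtains a where "cassini z1 z2 a = u" "a \<noteq> reflect z1 z2 a"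
proof
  define s where "s = csqrt (u + ((z2 - z1) / 2) ^ 2)"
  have s: "s ^ 2 = u + ((z2 - z1) / 2) ^ 2"
    by (simp add: s_def)
  then have "s \<noteq> 0"
    using assms by (auto simp: eq_neg_iff_add_eq_0)
  have "cassini z1 z2 ((z1 + z2) / 2 + s) = s ^ 2 - ((z2 - z1) / 2) ^ 2"
    by (simp add: cassini_def power2_eq_square field_simps)
  then show "cassini z1 z2 ((z1 + z2) / 2 + s) = u"
    by (simp add: s)
  show "(z1 + z2) / 2 + s \<noteq> reflect z1 z2 ((z1 + z2) / 2 + s)"
    using \<open>s \<noteq> 0\<close> by (simp add: reflect_def field_simps)
qed

text \<open>
  In the coordinate \<open>t = a - (z1 + z2) / 2\<close> the map \<open>cassini\<close> is \<open>t ^ 2 - D\<close> and \<open>reflect\<close> is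
  \<open>t \<mapsto> - t\<close>. The divided difference of \<open>q\<close> is an even function of \<open>t\<close>, with a removable singularity at
  \<open>t = 0\<close>, and so it is a holomorphic function of \<open>t ^ 2\<close>.
\<close>

lemma antisymmetrization_descends:
  assumes "open V" and q: "q holomorphic_on {w. cassini z1 z2 w \<in> V}"
  obtains g where "g holomorphic_on V"
    "\<And>a. cassini z1 z2 a \<in> V \<Longrightarrow> a \<noteq> reflect z1 z2 a \<Longrightarrow>
       g (cassini z1 z2 a) = (q a - q (reflect z1 z2 a)) / (a - reflect z1 z2 a)"
    "\<And>a. cassini z1 z2 a \<in> V \<Longrightarrow> a = reflect z1 z2 a \<Longrightarrow> g (cassini z1 z2 a) = deriv q a"
proof -
  define m where "m = (z1 + z2) / 2"
  define D where "D = ((z2 - z1) / 2) ^ 2"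
  have P: "cassini z1 z2 (m + t) = t ^ 2 - D" for t
    by (simp add: cassini_def m_def D_def power2_eq_square field_simps)
  have P': "cassini z1 z2 (m - t) = t ^ 2 - D" for t
    using P[of "- t"] by simp
  define V' where "V' = {v. v - D \<in> V}"
  have "open V'"
    unfolding V'_def using open_vimage[OF assms(1), of "\<lambda>v. v - D"] by (simp add: vimage_def continuous_intros)
  have W: "open {t :: complex. t ^ 2 \<in> V'}"
    using open_vimage[OF \<open>open V'\<close>, of "\<lambda>t::complex. t ^ 2"] by (simp add: vimage_def continuous_intros)
  define r where "r = (\<lambda>t. q (m + t) - q (m - t))"
  have "(\<lambda>t. q (m + t)) holomorphic_on {t. t ^ 2 \<in> V'}" "(\<lambda>t. q (m - t)) holomorphic_on {t. t ^ 2 \<in> V'}"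
    by (rule holomorphic_on_compose_gen[OF _ q, unfolded o_def]; force simp: P P' V'_def intro!: holomorphic_intros)+
  then have r: "r holomorphic_on {t. t ^ 2 \<in> V'}"
    unfolding r_def by (intro holomorphic_intros)
  define \<kappa> where "\<kappa> = (\<lambda>t. (if t = 0 then deriv r 0 else (r t - r 0) / (t - 0)) / 2)"
  have "\<kappa> holomorphic_on {t. t ^ 2 \<in> V'}"
    unfolding \<kappa>_def using pole_lemma_open[OF r W, of 0] by (intro holomorphic_intros) auto
  moreover have even: "\<kappa> (- t) = \<kappa> t" for t
    by (simp add: \<kappa>_def r_def field_simps)
  ultimately have "(\<lambda>v. \<kappa> (csqrt v)) holomorphic_on V'"
    using \<open>open V'\<close> by (intro even_function_csqrt_holomorphic)
  then have hol: "(\<lambda>u. \<kappa> (csqrt (u + D))) holomorphic_on V"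
    by (rule holomorphic_on_compose_gen[of "\<lambda>u. u + D" V "\<lambda>v. \<kappa> (csqrt v)", unfolded o_def, rotated])
      (auto simp: V'_def intro!: holomorphic_intros)
  have val: "\<kappa> (csqrt (cassini z1 z2 a + D)) = \<kappa> (a - m)" for a
  proof -
    have "cassini z1 z2 a + D = (a - m) ^ 2"
      using P[of "a - m"] by simp
    then have "csqrt (cassini z1 z2 a + D) ^ 2 = (a - m) ^ 2"
      by simp
    then show ?thesis
      using even power2_eq_iff by metis
  qed
  have refl: "reflect z1 z2 a = m - (a - m)" "a - reflect z1 z2 a = 2 * (a - m)" for a
    by (auto simp: reflect_def m_def field_simps)
  show ?thesis
  proof (rule that[OF hol])
    fix a assume "cassini z1 z2 a \<in> V" "a \<noteq> reflect z1 z2 a"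
    then show "\<kappa> (csqrt (cassini z1 z2 a + D)) = (q a - q (reflect z1 z2 a)) / (a - reflect z1 z2 a)"
      unfolding val refl(2) unfolding refl(1) by (auto simp: \<kappa>_def r_def)
  next
    fix a assume a: "cassini z1 z2 a \<in> V" "a = reflect z1 z2 a"
    then have "a = m"
      using refl(2)[of a] by simp
    have "open {w. cassini z1 z2 w \<in> V}"
      using open_vimage[OF assms(1), of "cassini z1 z2"]
      by (simp add: vimage_def cassini_def[abs_def] continuous_intros)
    then have "q field_differentiable at m"
      using q a \<open>a = m\<close> holomorphic_on_imp_differentiable_at by blast
    then have "(q has_field_derivative deriv q m) (at m)"
      by (simp add: field_differentiable_derivI)
    then have "((\<lambda>t. q (m + t)) has_field_derivative deriv q m * 1) (at 0)"
      "((\<lambda>t. q (m - t)) has_field_derivative deriv q m * (-1)) (at 0)"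
      by (intro DERIV_chain2[of q]; force intro!: derivative_eq_intros)+
    then have "(r has_field_derivative deriv q m * 1 - deriv q m * (-1)) (at 0)"
      unfolding r_def by (rule DERIV_diff)
    then show "\<kappa> (csqrt (cassini z1 z2 a + D)) = deriv q a"
      unfolding val using \<open>a = m\<close> by (simp add: \<kappa>_def DERIV_imp_deriv)
  qed
qed

text \<open>
  The weight vanishes at the reflection of \<open>z\<close>, which isolates the value \<open>h z\<close> at \<open>cassini z1 z2 z\<close>. The
  derivative in the previous lemma covers the case in which \<open>z\<close> is the midpoint of the foci.
\<close>

lemma weighted_antisymmetrization_descends:
  assumes "open V" and h: "h holomorphic_on {w. cassini z1 z2 w \<in> V}" and z: "cassini z1 z2 z \<in> V"
  obtains g where "g holomorphic_on V" "g (cassini z1 z2 z) = h z"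
    "\<And>a. cassini z1 z2 a \<in> V \<Longrightarrow> a \<noteq> reflect z1 z2 a \<Longrightarrow> g (cassini z1 z2 a) =
       (h a * (a - reflect z1 z2 z) - h (reflect z1 z2 a) * (reflect z1 z2 a - reflect z1 z2 z)) /
       (a - reflect z1 z2 a)"
proof -
  define q where "q = (\<lambda>w. h w * (w - reflect z1 z2 z))"
  have q: "q holomorphic_on {w. cassini z1 z2 w \<in> V}"
    unfolding q_def using h by (intro holomorphic_intros)
  obtain g where g: "g holomorphic_on V"
    "\<And>a. cassini z1 z2 a \<in> V \<Longrightarrow> a \<noteq> reflect z1 z2 a \<Longrightarrow>
       g (cassini z1 z2 a) = (q a - q (reflect z1 z2 a)) / (a - reflect z1 z2 a)"
    "\<And>a. cassini z1 z2 a \<in> V \<Longrightarrow> a = reflect z1 z2 a \<Longrightarrow> g (cassini z1 z2 a) = deriv q a"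
    by (rule antisymmetrization_descends[OF assms(1) q]) blast
  have "g (cassini z1 z2 z) = h z"
  proof (cases "z = reflect z1 z2 z")
    case True
    have "open {w. cassini z1 z2 w \<in> V}"
      using open_vimage[OF assms(1), of "cassini z1 z2"]
      by (simp add: vimage_def cassini_def[abs_def] continuous_intros)
    then have "h field_differentiable at z"
      using h z holomorphic_on_imp_differentiable_at by blast
    then have "(h has_field_derivative deriv h z) (at z)"
      by (simp add: field_differentiable_derivI)
    then have "(q has_field_derivative deriv h z * (z - z) + 1 * h z) (at z)"
      unfolding q_def True[symmetric] by (auto intro!: derivative_eq_intros)
    then show ?thesis
      using g(3)[OF z True] by (simp add: DERIV_imp_deriv)
  next
    case False
    then show ?thesis
      using g(2)[OF z False] by (simp add: q_def)
  qed
  then show ?thesis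
    using that[OF g(1)] g(2) by (simp add: q_def)
qed

section \<open>The finite expansion\<close>

text \<open>
  The numerators of the two coefficients combine by
  \<open>(z - z1) * (w - z1) - (z - z2) * (w - z2) = (z2 - z1) * (w - reflect z1 z2 z)\<close>.
\<close>

lemma regular_term_eq:
  assumes "open S" "f holomorphic_on S" "valid_path \<gamma>" "path_image \<gamma> \<subseteq> S" "z1 \<notin> S" "z2 \<notin> S" "z1 \<noteq> z2"
  shows "regular_term f \<gamma> z1 z2 z n = 1 / (2 * of_real pi * \<i>) *
    contour_integral \<gamma> (\<lambda>w. f w * (w - reflect z1 z2 z) / cassini z1 z2 w ^ Suc n) * cassini z1 z2 z ^ n"
proof -
  let ?A = "\<lambda>w. f w / ((w - z1) ^ n * (w - z2) ^ (n + 1))"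
  let ?B = "\<lambda>w. f w / ((w - z2) ^ n * (w - z1) ^ (n + 1))"
  have "?A holomorphic_on S" "?B holomorphic_on S"
    using assms by (auto intro!: holomorphic_intros)
  then have int: "?A contour_integrable_on \<gamma>" "?B contour_integrable_on \<gamma>"
    using contour_integrable_holomorphic_simple assms(1,3,4) by blast+
  have "contour_integral \<gamma> (\<lambda>w. f w * (w - reflect z1 z2 z) / cassini z1 z2 w ^ Suc n) =
      contour_integral \<gamma> (\<lambda>w. (z - z1) / (z2 - z1) * ?A w - (z - z2) / (z2 - z1) * ?B w)"
  proof (rule contour_integral_cong)
    fix w assume "w \<in> path_image \<gamma>"
    then have nz: "w - z1 \<noteq> 0" "w - z2 \<noteq> 0"
      using assms(4-6) by auto
    have "(w - reflect z1 z2 z) * (z2 - z1) = (z - z1) * (w - z1) - (z - z2) * (w - z2)"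
      by (simp add: reflect_def algebra_simps)
    then have *: "w - reflect z1 z2 z = ((z - z1) * (w - z1) - (z - z2) * (w - z2)) / (z2 - z1)"
      using assms(7) by (simp add: field_simps)
    have A: "?A w = f w * (w - z1) / cassini z1 z2 w ^ Suc n"
      "?B w = f w * (w - z2) / cassini z1 z2 w ^ Suc n"
      using nz by (simp_all add: cassini_def power_mult_distrib)
    have "F * ((a * b - c * e) / d) / C = a / d * (F * b / C) - c / d * (F * e / C)"
      for a b c d e C F :: complex
      by (simp add: diff_divide_distrib algebra_simps)
    then show "f w * (w - reflect z1 z2 z) / cassini z1 z2 w ^ Suc n =
        (z - z1) / (z2 - z1) * ?A w - (z - z2) / (z2 - z1) * ?B w"
      unfolding A * by blast
  qed simp
  also have "\<dots> = (z - z1) / (z2 - z1) * contour_integral \<gamma> ?A - (z - z2) / (z2 - z1) * contour_integral \<gamma> ?B"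
    using int by (simp only: contour_integral_diff contour_integral_lmul contour_integrable_lmul)
  finally have int_eq: "contour_integral \<gamma> (\<lambda>w. f w * (w - reflect z1 z2 z) / cassini z1 z2 w ^ Suc n) =
      (z - z1) / (z2 - z1) * contour_integral \<gamma> ?A - (z - z2) / (z2 - z1) * contour_integral \<gamma> ?B" .
  have term_eq: "regular_term f \<gamma> z1 z2 z n = (1 / (2 * of_real pi * \<i> * (z2 - z1)) * contour_integral \<gamma> ?A * (z - z1) +
      1 / (2 * of_real pi * \<i> * - (z2 - z1)) * contour_integral \<gamma> ?B * (z - z2)) * (z - z1) ^ n * (z - z2) ^ n"
    by (simp only: regular_term_def coeff_b_def minus_diff_eq)
  have alg: "(1 / (c * d) * a * x + 1 / (c * - d) * b * y) * X * Y = 1 / c * (x / d * a - y / d * b) * (X * Y)"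
    if "c \<noteq> 0" "d \<noteq> 0" for a b c d x y X Y :: complex
    using that by (simp add: field_simps)
  show ?thesis
    unfolding term_eq int_eq unfolding cassini_def power_mult_distrib
    by (rule alg) (use assms(7) in simp_all)
qed

lemma singular_term_eq:
  assumes "open S" "f holomorphic_on S" "valid_path \<gamma>" "path_image \<gamma> \<subseteq> S" "z1 \<noteq> z2"
  shows "singular_term f \<gamma> z1 z2 z n = 1 / (2 * of_real pi * \<i>) *
    contour_integral \<gamma> (\<lambda>w. f w * (w - reflect z1 z2 z) * cassini z1 z2 w ^ n) / cassini z1 z2 z ^ Suc n"
proof -
  let ?A = "\<lambda>w. (w - z1) ^ (n + 1) * (w - z2) ^ n * f w"
  let ?B = "\<lambda>w. (w - z2) ^ (n + 1) * (w - z1) ^ n * f w"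
  have "?A holomorphic_on S" "?B holomorphic_on S"
    using assms by (auto intro!: holomorphic_intros)
  then have int: "?A contour_integrable_on \<gamma>" "?B contour_integrable_on \<gamma>"
    using contour_integrable_holomorphic_simple assms(1,3,4) by blast+
  have "contour_integral \<gamma> (\<lambda>w. f w * (w - reflect z1 z2 z) * cassini z1 z2 w ^ n) =
      contour_integral \<gamma> (\<lambda>w. (z - z1) / (z2 - z1) * ?A w - (z - z2) / (z2 - z1) * ?B w)"
  proof (rule contour_integral_cong)
    fix w
    have "(w - reflect z1 z2 z) * (z2 - z1) = (z - z1) * (w - z1) - (z - z2) * (w - z2)"
      by (simp add: reflect_def algebra_simps)
    then have *: "w - reflect z1 z2 z = ((z - z1) * (w - z1) - (z - z2) * (w - z2)) / (z2 - z1)"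
      using assms(5) by (simp add: field_simps)
    have A: "?A w = f w * (w - z1) * cassini z1 z2 w ^ n"
      "?B w = f w * (w - z2) * cassini z1 z2 w ^ n"
      by (simp_all add: cassini_def power_mult_distrib)
    have "F * ((a * b - c * e) / d) * C = a / d * (F * b * C) - c / d * (F * e * C)"
      for a b c d e C F :: complex
      by (simp add: diff_divide_distrib algebra_simps)
    then show "f w * (w - reflect z1 z2 z) * cassini z1 z2 w ^ n =
        (z - z1) / (z2 - z1) * ?A w - (z - z2) / (z2 - z1) * ?B w"
      unfolding A * by blast
  qed simp
  also have "\<dots> = (z - z1) / (z2 - z1) * contour_integral \<gamma> ?A - (z - z2) / (z2 - z1) * contour_integral \<gamma> ?B"
    using int by (simp only: contour_integral_diff contour_integral_lmul contour_integrable_lmul)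
  finally have int_eq: "contour_integral \<gamma> (\<lambda>w. f w * (w - reflect z1 z2 z) * cassini z1 z2 w ^ n) =
      (z - z1) / (z2 - z1) * contour_integral \<gamma> ?A - (z - z2) / (z2 - z1) * contour_integral \<gamma> ?B" .
  have powi:  "x powi (- int n - 1) = 1 / x ^ Suc n" for x :: complex
  proof -
    have "- int n - 1 = - int (Suc n)"
      by simp
    then show ?thesis
      by (simp only: power_int_minus power_int_of_nat inverse_eq_divide)
  qed
  have term_eq: "singular_term f \<gamma> z1 z2 z n = (1 / (2 * of_real pi * \<i> * (z2 - z1)) * contour_integral \<gamma> ?A * (z - z1) +
      1 / (2 * of_real pi * \<i> * - (z2 - z1)) * contour_integral \<gamma> ?B * (z - z2)) *
      (1 / (z - z1) ^ Suc n) * (1 / (z - z2) ^ Suc n)"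
    by (simp only: singular_term_def coeff_c_def minus_diff_eq powi)
  have alg: "(1 / (c * d) * a * x + 1 / (c * - d) * b * y) * (1 / X) * (1 / Y) =
      1 / c * (x / d * a - y / d * b) / (X * Y)"
    if "c \<noteq> 0" "d \<noteq> 0" for a b c d x y X Y :: complex
    using that by (simp add: field_simps)
  show ?thesis
    unfolding term_eq int_eq unfolding cassini_def power_mult_distrib
    by (rule alg) (use assms(5) in simp_all)
qed

text \<open>
  This is Cauchy's integral formula for the cycle \<open>\<Gamma>1 - \<Gamma>2\<close>, which surrounds \<open>z\<close> once: the
  difference quotient of \<open>f\<close> at \<open>z\<close> is holomorphic on \<open>S\<close> and has the same integral along both loops.
\<close>

lemma remainder_0:
  assumes "open S" "f holomorphic_on S" "valid_path \<Gamma>1" "valid_path \<Gamma>2" "z \<in> S"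
    and "path_image \<Gamma>1 \<subseteq> S" "path_image \<Gamma>2 \<subseteq> S" "z \<notin> path_image \<Gamma>1" "z \<notin> path_image \<Gamma>2"
    and "winding_number \<Gamma>1 z = 1" "winding_number \<Gamma>2 z = 0"
    and eq: "\<And>h. h holomorphic_on S \<Longrightarrow> contour_integral \<Gamma>1 h = contour_integral \<Gamma>2 h"
  shows "remainder f \<Gamma>1 \<Gamma>2 0 z1 z2 z = f z"
proof -
  have "dixon_transform \<Gamma>1 f z = dixon_transform \<Gamma>2 f z"
    using eq[OF difference_quotient_holomorphic[OF assms(2,1)]] by (simp add: dixon_transform_def)
  then show ?thesis
    using dixon_transform_eq[OF assms(1,2)] assms
    by (simp add: remainder_def cauchy_transform_def algebra_simps)
qed

text \<open>
  One step of the two geometric expansions of the Cauchy kernel, using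
  \<open>(P w - P z) / (w - z) = w - reflect z1 z2 z\<close> for \<open>P = cassini z1 z2\<close>.
\<close>

lemma remainder_Suc:
  assumes "open S" "f holomorphic_on S" "valid_path \<Gamma>1" "valid_path \<Gamma>2" "z \<in> S"
    and "path_image \<Gamma>1 \<subseteq> S - {z}" "path_image \<Gamma>2 \<subseteq> S - {z}" "z1 \<notin> S" "z2 \<notin> S" "z1 \<noteq> z2"
  shows "remainder f \<Gamma>1 \<Gamma>2 N z1 z2 z =
    regular_term f \<Gamma>1 z1 z2 z N + singular_term f \<Gamma>2 z1 z2 z N + remainder f \<Gamma>1 \<Gamma>2 (Suc N) z1 z2 z"
proof -
  let ?P = "cassini z1 z2"
  have \<Gamma>: "path_image \<Gamma>1 \<subseteq> S" "path_image \<Gamma>2 \<subseteq> S"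
    using assms(6,7) by auto
  have "?P z \<noteq> 0"
    using assms by (auto simp: cassini_def)
  have nz: "?P w \<noteq> 0" if "w \<in> S" for w
    using that assms by (auto simp: cassini_def)
  have hol: "f holomorphic_on S - {z}" and op: "open (S - {z})"
    using assms(1,2) by (auto intro: holomorphic_on_subset)
  define A where "A = (\<lambda>n. contour_integral \<Gamma>1 (\<lambda>w. f w / (?P w ^ n * (w - z))))"
  define B where "B = (\<lambda>n. contour_integral \<Gamma>2 (\<lambda>w. ?P w ^ n * f w / (w - z)))"
  have "(\<lambda>w. f w / (?P w ^ n * (w - z))) holomorphic_on S - {z}" for n
    using hol nz by (intro holomorphic_intros) auto
  then have intA: "(\<lambda>w. f w / (?P w ^ n * (w - z))) contour_integrable_on \<Gamma>1" for n
    using contour_integrable_holomorphic_simple op assms(3,6) by blast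
  have "(\<lambda>w. ?P w ^ n * f w / (w - z)) holomorphic_on S - {z}" for n
    using hol by (intro holomorphic_intros) auto
  then have intB: "(\<lambda>w. ?P w ^ n * f w / (w - z)) contour_integrable_on \<Gamma>2" for n
    using contour_integrable_holomorphic_simple op assms(4,7) by blast
  have "contour_integral \<Gamma>1 (\<lambda>w. f w * (w - reflect z1 z2 z) / ?P w ^ Suc N) =
      contour_integral \<Gamma>1 (\<lambda>w. f w / (?P w ^ N * (w - z)) - ?P z * (f w / (?P w ^ Suc N * (w - z))))"
  proof (rule contour_integral_cong)
    fix w assume "w \<in> path_image \<Gamma>1"
    then have w: "w - z \<noteq> 0" "?P w \<noteq> 0"
      using assms(6) nz by auto
    have "F / (X * y) - q * (F / (p * X * y)) = F * (p - q) / (p * X * y)"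
      if "p \<noteq> 0" "X \<noteq> 0" "y \<noteq> 0" for F X y p q :: complex
      using that by (simp add: field_simps)
    from this[of "?P w" "?P w ^ N" "w - z" "f w" "?P z"]
    have "f w / (?P w ^ N * (w - z)) - ?P z * (f w / (?P w ^ Suc N * (w - z))) =
        f w * (?P w - ?P z) / (?P w ^ Suc N * (w - z))"
      using w by simp
    also have "\<dots> = f w * (w - reflect z1 z2 z) / ?P w ^ Suc N"
      unfolding cassini_diff using w(1) by (simp add: mult.left_commute mult.commute)
    finally show "f w * (w - reflect z1 z2 z) / ?P w ^ Suc N =
        f w / (?P w ^ N * (w - z)) - ?P z * (f w / (?P w ^ Suc N * (w - z)))" ..
  qed simp
  also have "\<dots> = A N - ?P z * A (Suc N)"
    unfolding A_def using intA by (simp only: contour_integral_diff contour_integral_lmul contour_integrable_lmul)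
  finally have reg: "regular_term f \<Gamma>1 z1 z2 z N =
      1 / (2 * of_real pi * \<i>) * (A N - ?P z * A (Suc N)) * ?P z ^ N"
    using regular_term_eq[OF assms(1-3) \<Gamma>(1) assms(8-10)] by simp
  have "contour_integral \<Gamma>2 (\<lambda>w. f w * (w - reflect z1 z2 z) * ?P w ^ N) =
      contour_integral \<Gamma>2 (\<lambda>w. ?P w ^ Suc N * f w / (w - z) - ?P z * (?P w ^ N * f w / (w - z)))"
  proof (rule contour_integral_cong)
    fix w assume "w \<in> path_image \<Gamma>2"
    then have w: "w - z \<noteq> 0"
      using assms(7) by auto
    have "?P w ^ Suc N * f w / (w - z) - ?P z * (?P w ^ N * f w / (w - z)) =
        ?P w ^ N * f w * (?P w - ?P z) / (w - z)"
      by (simp add: diff_divide_distrib algebra_simps)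
    also have "\<dots> = f w * (w - reflect z1 z2 z) * ?P w ^ N"
      unfolding cassini_diff using w by (simp add: mult_ac)
    finally show "f w * (w - reflect z1 z2 z) * ?P w ^ N =
        ?P w ^ Suc N * f w / (w - z) - ?P z * (?P w ^ N * f w / (w - z))" ..
  qed simp
  also have "\<dots> = B (Suc N) - ?P z * B N"
    unfolding B_def using intB by (simp only: contour_integral_diff contour_integral_lmul contour_integrable_lmul)
  finally have sing: "singular_term f \<Gamma>2 z1 z2 z N =
      1 / (2 * of_real pi * \<i>) * (B (Suc N) - ?P z * B N) / ?P z ^ Suc N"
    using singular_term_eq[OF assms(1,2,4) \<Gamma>(2) assms(10)] by simp
  have rem: "remainder f \<Gamma>1 \<Gamma>2 n z1 z2 z =
      1 / (2 * of_real pi * \<i>) * (A n * ?P z ^ n - B n / ?P z ^ n)" for n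
    unfolding remainder_def A_def B_def cassini_def power_mult_distrib
    by (simp add: diff_divide_distrib mult_ac)
  show ?thesis
    unfolding rem reg sing using \<open>?P z \<noteq> 0\<close> by (simp add: field_simps)
qed

section \<open>Convergence in the Cassini annulus\<close>

text \<open>
  Partial fractions with respect to the two roots \<open>a\<close> and \<open>reflect z1 z2 a\<close> of
  \<open>cassini z1 z2 w = cassini z1 z2 a\<close>. This identifies the function obtained by descent as the
  generating function of the coefficients of the expansion.
\<close>

lemma cauchy_transform_pair:
  assumes "open S" "f holomorphic_on S" "valid_path \<gamma>" "path_image \<gamma> \<subseteq> S"
    and "a \<notin> path_image \<gamma>" "reflect z1 z2 a \<notin> path_image \<gamma>" "a \<noteq> reflect z1 z2 a"
  shows "(\<lambda>w. f w * (w - p) / (cassini z1 z2 w - cassini z1 z2 a)) contour_integrable_on \<gamma>" (is ?integrable)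
    and "(cauchy_transform \<gamma> f a * (a - p) -
        cauchy_transform \<gamma> f (reflect z1 z2 a) * (reflect z1 z2 a - p)) / (a - reflect z1 z2 a) =
      1 / (2 * of_real pi * \<i>) *
        contour_integral \<gamma> (\<lambda>w. f w * (w - p) / (cassini z1 z2 w - cassini z1 z2 a))" (is ?eq)
proof -
  define b where "b = reflect z1 z2 a"
  have op: "open (S - {a, b})" and hol: "f holomorphic_on S - {a, b}"
    using assms(1,2) by (auto intro: holomorphic_on_subset simp: open_delete open_Diff)
  have sub: "path_image \<gamma> \<subseteq> S - {a, b}"
    using assms by (auto simp: b_def)
  have integrable: "h contour_integrable_on \<gamma>" if "h holomorphic_on S - {a, b}" for h
    using contour_integrable_holomorphic_simple[OF that op assms(3) sub] .
  have "(\<lambda>w. f w * (w - p) / ((w - a) * (w - b))) holomorphic_on S - {a, b}"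
    using hol by (intro holomorphic_intros) auto
  then show ?integrable
    unfolding cassini_diff using integrable by (simp add: b_def)
  have int: "(\<lambda>w. f w / (w - a)) contour_integrable_on \<gamma>" "(\<lambda>w. f w / (w - b)) contour_integrable_on \<gamma>"
    using hol by (auto intro!: integrable holomorphic_intros)
  have alg: "F * (w - p) / ((w - a) * (w - b)) =
      (a - p) / (a - b) * (F / (w - a)) - (b - p) / (a - b) * (F / (w - b))"
    if "w \<noteq> a" "w \<noteq> b" for F w
    using that assms(7) unfolding b_def[symmetric] by (simp add: divide_simps) (simp add: algebra_simps)
  have "contour_integral \<gamma> (\<lambda>w. f w * (w - p) / (cassini z1 z2 w - cassini z1 z2 a)) =
      contour_integral \<gamma> (\<lambda>w. (a - p) / (a - b) * (f w / (w - a)) - (b - p) / (a - b) * (f w / (w - b)))"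
    unfolding cassini_diff b_def[symmetric] using sub by (intro contour_integral_cong alg) auto
  also have "\<dots> = (a - p) / (a - b) * contour_integral \<gamma> (\<lambda>w. f w / (w - a)) -
      (b - p) / (a - b) * contour_integral \<gamma> (\<lambda>w. f w / (w - b))"
    using int by (simp only: contour_integral_diff contour_integral_lmul contour_integrable_lmul)
  finally have int_eq: "contour_integral \<gamma> (\<lambda>w. f w * (w - p) / (cassini z1 z2 w - cassini z1 z2 a)) =
      (a - p) / (a - b) * contour_integral \<gamma> (\<lambda>w. f w / (w - a)) -
      (b - p) / (a - b) * contour_integral \<gamma> (\<lambda>w. f w / (w - b))" .
  have collect: "(c * A * x - c * B * y) / d = c * (x / d * A - y / d * B)" for c A B x y d :: complex
    by (simp add: diff_divide_distrib algebra_simps)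
  show ?eq
    unfolding cauchy_transform_def b_def[symmetric] int_eq by (rule collect)
qed

lemma small_cassini_subset:
  assumes "open A" "z1 \<in> A" "z2 \<in> A"
  obtains \<delta> where "\<delta> > 0" "\<And>a. norm (cassini z1 z2 a) < \<delta> \<Longrightarrow> a \<in> A"
proof -
  obtain d1 d2 where d: "d1 > 0" "ball z1 d1 \<subseteq> A" "d2 > 0" "ball z2 d2 \<subseteq> A"
    using assms open_contains_ball by metis
  have "a \<in> A" if "norm (cassini z1 z2 a) < d1 * d2" for a
  proof (rule ccontr)
    assume "a \<notin> A"
    then have "d1 \<le> norm (a - z1)" "d2 \<le> norm (a - z2)"
      using d by (auto simp: subset_iff dist_norm norm_minus_commute not_less[symmetric])
    then have "d1 * d2 \<le> norm (a - z1) * norm (a - z2)"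
      using d by (intro mult_mono) auto
    then show False
      using that by (simp add: cassini_def norm_mult)
  qed
  then show ?thesis
    using that[of "d1 * d2"] d by simp
qed

text \<open>
  The descended function \<open>g\<close> of \<open>f1\<close> is holomorphic on the disc of radius \<open>r\<close>, because the preimage of
  this disc under \<open>cassini\<close> lies in \<open>\<Omega>\<close>. For small \<open>u\<close> both preimages of \<open>u\<close> are near the foci, inside
  the loop, where \<open>f1\<close> is the Cauchy transform; there \<open>g\<close> is the sum of the series.
\<close>

lemma regular_series_sums:
  assumes "open \<Omega>" "closed \<Omega>\<^sub>0" "f holomorphic_on \<Omega> - \<Omega>\<^sub>0" "admissible_loop \<Omega> \<Omega>\<^sub>0 \<gamma>"
    and "z1 \<in> \<Omega>\<^sub>0" "z2 \<in> \<Omega>\<^sub>0" "z1 \<noteq> z2"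
    and f1: "f1 holomorphic_on \<Omega>" "\<And>z. z \<in> inside (path_image \<gamma>) \<Longrightarrow> f1 z = cauchy_transform \<gamma> f z"
    and r: "\<And>w. norm (cassini z1 z2 w) < r \<Longrightarrow> w \<in> \<Omega>" "norm (cassini z1 z2 z) < r"
  shows "regular_term f \<gamma> z1 z2 z sums f1 z"
proof -
  let ?P = "cassini z1 z2"
  define p where "p = reflect z1 z2 z"
  note \<gamma> = admissible_loopD[OF assms(4)]
  have U: "open (\<Omega> - \<Omega>\<^sub>0)"
    using assms by blast
  have nz: "?P w \<noteq> 0" if "w \<in> \<Omega> - \<Omega>\<^sub>0" for w
    using that assms by (auto simp: cassini_def)
  have h: "f1 holomorphic_on {w. ?P w \<in> ball 0 r}"
    using f1(1) by (rule holomorphic_on_subset) (use r in auto)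
  have zr: "?P z \<in> ball 0 r"
    using r(2) by simp
  obtain g where g: "g holomorphic_on ball 0 r" "g (?P z) = f1 z"
    and ga: "\<And>a. ?P a \<in> ball 0 r \<Longrightarrow> a \<noteq> reflect z1 z2 a \<Longrightarrow> g (?P a) =
       (f1 a * (a - p) - f1 (reflect z1 z2 a) * (reflect z1 z2 a - p)) / (a - reflect z1 z2 a)"
    unfolding p_def by (rule weighted_antisymmetrization_descends[OF open_ball h zr]) blast
  have kQ: "(\<lambda>w. f w * (w - p) / ?P w) holomorphic_on \<Omega> - \<Omega>\<^sub>0" "(\<lambda>w. 1 / ?P w) holomorphic_on \<Omega> - \<Omega>\<^sub>0"
    using assms(3) nz by (auto intro!: holomorphic_intros)
  obtain \<epsilon> where \<epsilon>: "\<epsilon> > 0"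
    "\<And>u. norm u < \<epsilon> \<Longrightarrow> (\<lambda>n. contour_integral \<gamma> (\<lambda>w. f w * (w - p) / ?P w * (1 / ?P w) ^ n) * u ^ n) sums
       contour_integral \<gamma> (\<lambda>w. f w * (w - p) / ?P w / (1 - u * (1 / ?P w)))"
    by (rule contour_integral_power_series_coefficients[OF U kQ \<gamma>(1,4)]) blast
  obtain \<delta> where \<delta>: "\<delta> > 0" "\<And>a. norm (?P a) < \<delta> \<Longrightarrow> a \<in> inside (path_image \<gamma>)"
    using small_cassini_subset[of "inside (path_image \<gamma>)" z1 z2] \<gamma>(6,7) assms(5,6) by blast
  define D where "D = ((z2 - z1) / 2) ^ 2"
  \<comment> \<open>The bound \<open>norm D\<close> keeps \<open>u\<close> away from the critical value \<open>- D\<close>, where the two roots coincide.\<close>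
  define \<eta> where "\<eta> = min (min \<epsilon> \<delta>) (min (norm D) r)"
  have "r > 0"
    using r(2) norm_ge_zero le_less_trans by blast
  then have \<eta>: "\<eta> > 0" "\<eta> \<le> \<epsilon>" "\<eta> \<le> \<delta>" "\<eta> \<le> norm D" "\<eta> \<le> r"
    using \<epsilon>(1) \<delta>(1) assms(7) by (auto simp: \<eta>_def D_def)
  define c where "c = (\<lambda>n. 1 / (2 * of_real pi * \<i>) *
      contour_integral \<gamma> (\<lambda>w. f w * (w - p) / ?P w ^ Suc n))"
  have "(\<lambda>n. c n * u ^ n) sums g u" if u: "norm u < \<eta>" for u
  proof -
    have "u \<noteq> - D"
      using u \<eta>(4) by auto
    then obtain a where a: "?P a = u" "a \<noteq> reflect z1 z2 a"
      using cassini_root[of u z2 z1] unfolding D_def by metis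
    have ain: "a \<in> inside (path_image \<gamma>)" "reflect z1 z2 a \<in> inside (path_image \<gamma>)"
      using \<delta>(2) a(1) u \<eta>(3) by simp_all
    then have aout: "a \<notin> path_image \<gamma>" "reflect z1 z2 a \<notin> path_image \<gamma>"
      using inside_no_overlap by blast+
    have "g u = (f1 a * (a - p) - f1 (reflect z1 z2 a) * (reflect z1 z2 a - p)) / (a - reflect z1 z2 a)"
      using ga[OF _ a(2)] a(1) u \<eta>(5) by simp
    also have "\<dots> = 1 / (2 * of_real pi * \<i>) * contour_integral \<gamma> (\<lambda>w. f w * (w - p) / (?P w - u))"
      using cauchy_transform_pair(2)[OF U assms(3) \<gamma>(1,4) aout a(2)] f1(2) ain a(1) by simp
    also have "contour_integral \<gamma> (\<lambda>w. f w * (w - p) / (?P w - u)) =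
        contour_integral \<gamma> (\<lambda>w. f w * (w - p) / ?P w / (1 - u * (1 / ?P w)))"
    proof (rule contour_integral_cong)
      fix w assume "w \<in> path_image \<gamma>"
      then have "?P w \<noteq> 0"
        using nz \<gamma>(4) by blast
      then have "1 - u * (1 / ?P w) = (?P w - u) / ?P w"
        by (simp add: diff_divide_distrib)
      then show "f w * (w - p) / (?P w - u) = f w * (w - p) / ?P w / (1 - u * (1 / ?P w))"
        using \<open>?P w \<noteq> 0\<close> by simp
    qed simp
    finally have gu: "g u = 1 / (2 * of_real pi * \<i>) *
        contour_integral \<gamma> (\<lambda>w. f w * (w - p) / ?P w / (1 - u * (1 / ?P w)))" .
    have "(\<lambda>n. 1 / (2 * of_real pi * \<i>) *
        (contour_integral \<gamma> (\<lambda>w. f w * (w - p) / ?P w * (1 / ?P w) ^ n) * u ^ n)) sums g u"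
      unfolding gu using u \<eta>(2) by (intro sums_mult \<epsilon>(2)) simp
    then show ?thesis
      by (simp add: c_def power_one_over mult.assoc)
  qed
  then have "(\<lambda>n. c n * ?P z ^ n) sums f1 z"
    using power_series_sums_on_ball[OF g(1) \<eta>(1) _ r(2)] g(2) by simp
  moreover have "regular_term f \<gamma> z1 z2 z n = c n * ?P z ^ n" for n
    using regular_term_eq[OF U assms(3) \<gamma>(1,4)] assms(5-7) by (simp add: c_def p_def)
  then have "regular_term f \<gamma> z1 z2 z = (\<lambda>n. c n * ?P z ^ n)"
    by (rule ext)
  ultimately show ?thesis
    by (simp only:)
qed

text \<open>
  Here the descended function lives on \<open>\<bar>u\<bar> > \<rho>\<close>, and the series is a power series in \<open>v = 1 / u\<close>. For small
  \<open>v\<close> both preimages of \<open>u\<close> are outside the loop, where \<open>f2\<close> is minus the Cauchy transform. The power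
  series itself provides the holomorphic extension to \<open>v = 0\<close>.
\<close>

lemma singular_series_sums:
  assumes "open \<Omega>" "closed \<Omega>\<^sub>0" "f holomorphic_on \<Omega> - \<Omega>\<^sub>0" "admissible_loop \<Omega> \<Omega>\<^sub>0 \<gamma>" "z1 \<noteq> z2"
    and f2: "f2 holomorphic_on - \<Omega>\<^sub>0" "\<And>z. z \<in> outside (path_image \<gamma>) \<Longrightarrow> f2 z = - cauchy_transform \<gamma> f z"
    and \<rho>: "\<rho> > 0" "\<And>w. \<rho> < norm (cassini z1 z2 w) \<Longrightarrow> w \<notin> \<Omega>\<^sub>0" "\<rho> < norm (cassini z1 z2 z)"
  shows "singular_term f \<gamma> z1 z2 z sums f2 z"
proof -
  let ?P = "cassini z1 z2"
  define p where "p = reflect z1 z2 z"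
  note \<gamma> = admissible_loopD[OF assms(4)]
  have U: "open (\<Omega> - \<Omega>\<^sub>0)"
    using assms by blast
  define V where "V = {u :: complex. \<rho> < norm u}"
  have "open V"
    unfolding V_def by (intro open_Collect_less continuous_intros)
  have h: "f2 holomorphic_on {w. ?P w \<in> V}"
    using f2(1) by (rule holomorphic_on_subset) (use \<rho> in \<open>auto simp: V_def\<close>)
  have zV: "?P z \<in> V"
    using \<rho>(3) by (simp add: V_def)
  obtain g where g: "g holomorphic_on V" "g (?P z) = f2 z"
    and ga: "\<And>a. ?P a \<in> V \<Longrightarrow> a \<noteq> reflect z1 z2 a \<Longrightarrow> g (?P a) =
       (f2 a * (a - p) - f2 (reflect z1 z2 a) * (reflect z1 z2 a - p)) / (a - reflect z1 z2 a)"
    unfolding p_def by (rule weighted_antisymmetrization_descends[OF \<open>open V\<close> h zV]) blast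
  have kQ: "(\<lambda>w. f w * (w - p)) holomorphic_on \<Omega> - \<Omega>\<^sub>0" "?P holomorphic_on \<Omega> - \<Omega>\<^sub>0"
    using assms(3) by (auto intro!: holomorphic_intros)
  obtain \<epsilon> where \<epsilon>: "\<epsilon> > 0"
    "\<And>v. norm v < \<epsilon> \<Longrightarrow> (\<lambda>n. contour_integral \<gamma> (\<lambda>w. f w * (w - p) * ?P w ^ n) * v ^ n) sums
       contour_integral \<gamma> (\<lambda>w. f w * (w - p) / (1 - v * ?P w))"
    by (rule contour_integral_power_series_coefficients[OF U kQ \<gamma>(1,4)]) blast
  define D where "D = ((z2 - z1) / 2) ^ 2"
  have "compact (?P ` (inside (path_image \<gamma>) \<union> path_image \<gamma>))"
    using \<gamma>(12) holomorphic_on_imp_continuous_on[OF cassini_holomorphic] by (intro compact_continuous_image)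
  then obtain M0 where M0: "\<And>w. w \<in> inside (path_image \<gamma>) \<union> path_image \<gamma> \<Longrightarrow> norm (?P w) \<le> M0"
    using compact_imp_bounded bounded_iff by (metis image_eqI)
  define M where "M = max M0 (max (norm D) \<rho>)"
  have M: "M > 0" "norm D \<le> M" "\<rho> \<le> M" "\<And>w. M < norm (?P w) \<Longrightarrow> w \<in> outside (path_image \<gamma>)"
    using \<rho>(1) M0 \<gamma>(11) by (force simp: M_def)+
  define \<eta> where "\<eta> = min \<epsilon> (1 / M)"
  have \<eta>: "\<eta> > 0" "\<eta> \<le> \<epsilon>"
    using \<epsilon>(1) M(1) by (auto simp: \<eta>_def)
  define C where "C = (\<lambda>n. 1 / (2 * of_real pi * \<i>) *
      contour_integral \<gamma> (\<lambda>w. f w * (w - p) * ?P w ^ n))"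
  \<comment> \<open>The shift by one accounts for the exponent \<open>n + 1\<close> of \<open>1 / P z\<close> in the singular terms.\<close>
  define c where "c = (\<lambda>n. case n of 0 \<Rightarrow> 0 | Suc m \<Rightarrow> C m)"
  define G where "G = (\<lambda>v. if v = 0 then 0 else g (1 / v))"
  have near0: "(\<lambda>n. c n * v ^ n) sums G v" if v: "norm v < \<eta>" for v
  proof (cases "v = 0")
    case True
    then show ?thesis
      by (simp add: c_def G_def)
  next
    case False
    define u where "u = 1 / v"
    have "norm v * M < 1"
      using v M(1) by (simp add: \<eta>_def field_simps)
    then have u: "M < norm u"
      using False by (simp add: u_def norm_divide field_simps)
    then have "u \<noteq> - D"
      using M(2) by auto
    then obtain a where a: "?P a = u" "a \<noteq> reflect z1 z2 a"
      using cassini_root[of u z2 z1] unfolding D_def by metis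
    have ain: "a \<in> outside (path_image \<gamma>)" "reflect z1 z2 a \<in> outside (path_image \<gamma>)"
      using M(4) a(1) u by simp_all
    then have aout: "a \<notin> path_image \<gamma>" "reflect z1 z2 a \<notin> path_image \<gamma>"
      using outside_no_overlap by blast+
    note pair = cauchy_transform_pair[OF U assms(3) \<gamma>(1,4) aout a(2)]
    have "G v = (f2 a * (a - p) - f2 (reflect z1 z2 a) * (reflect z1 z2 a - p)) / (a - reflect z1 z2 a)"
      using ga[OF _ a(2)] a(1) u M(3) False by (simp add: V_def G_def u_def)
    also have "\<dots> = - ((cauchy_transform \<gamma> f a * (a - p) -
        cauchy_transform \<gamma> f (reflect z1 z2 a) * (reflect z1 z2 a - p)) / (a - reflect z1 z2 a))"
      using f2(2) ain by (simp add: minus_divide_left)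
    also have "\<dots> = 1 / (2 * of_real pi * \<i>) * - contour_integral \<gamma> (\<lambda>w. f w * (w - p) / (?P w - u))"
      unfolding pair(2) a(1) by simp
    also have "- contour_integral \<gamma> (\<lambda>w. f w * (w - p) / (?P w - u)) =
        v * contour_integral \<gamma> (\<lambda>w. - u * (f w * (w - p) / (?P w - u)))"
      using pair(1)[of p] False unfolding a(1) by (subst contour_integral_lmul) (auto simp: u_def)
    also have "contour_integral \<gamma> (\<lambda>w. - u * (f w * (w - p) / (?P w - u))) =
        contour_integral \<gamma> (\<lambda>w. f w * (w - p) / (1 - v * ?P w))"
    proof (rule contour_integral_cong)
      fix w
      have "1 - v * ?P w = - v * (?P w - u)"
        using False by (simp add: u_def algebra_simps)
      then show "- u * (f w * (w - p) / (?P w - u)) = f w * (w - p) / (1 - v * ?P w)"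
        by (simp add: u_def)
    qed simp
    finally have Gv: "G v = 1 / (2 * of_real pi * \<i>) *
        (v * contour_integral \<gamma> (\<lambda>w. f w * (w - p) / (1 - v * ?P w)))" .
    have "(\<lambda>n. 1 / (2 * of_real pi * \<i>) *
        (v * (contour_integral \<gamma> (\<lambda>w. f w * (w - p) * ?P w ^ n) * v ^ n))) sums G v"
      unfolding Gv using v \<eta>(2) by (intro sums_mult \<epsilon>(2)) simp
    moreover have "1 / (2 * of_real pi * \<i>) * (v * (contour_integral \<gamma> (\<lambda>w. f w * (w - p) * ?P w ^ n) * v ^ n)) =
        c (Suc n) * v ^ Suc n" for n
      by (simp add: c_def C_def mult_ac)
    ultimately have "(\<lambda>n. c (Suc n) * v ^ Suc n) sums G v"
      by (simp only:)
    then show ?thesis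
      using sums_Suc[of "\<lambda>n. c n * v ^ n"] by (simp add: c_def)
  qed
  have "G holomorphic_on ball 0 \<eta> \<union> (ball 0 (1 / \<rho>) - {0})"
  proof (rule holomorphic_on_Un)
    show "G holomorphic_on ball 0 \<eta>"
      by (rule power_series_holomorphic[of 0 \<eta> c]) (use near0 in simp)
    have "(\<lambda>v. 1 / v) ` (ball 0 (1 / \<rho>) - {0}) \<subseteq> V"
      using \<rho>(1) by (auto simp: V_def norm_divide field_simps)
    then have "(\<lambda>v. g (1 / v)) holomorphic_on ball 0 (1 / \<rho>) - {0}"
      by (intro holomorphic_on_compose_gen[OF _ g(1), of "\<lambda>v. 1 / v", unfolded o_def] holomorphic_intros) auto
    then show "G holomorphic_on ball 0 (1 / \<rho>) - {0}"
      by (rule holomorphic_transform) (simp add: G_def)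
  qed auto
  then have "G holomorphic_on ball 0 (1 / \<rho>)"
    by (rule holomorphic_on_subset) (use \<eta>(1) in auto)
  moreover have nz: "?P z \<noteq> 0"
    using \<rho>(1,3) by auto
  moreover have "norm (1 / ?P z) < 1 / \<rho>"
    using \<rho>(1,3) frac_less2[of 1 1 \<rho> "norm (?P z)"] by (simp add: norm_divide)
  ultimately have "(\<lambda>n. c n * (1 / ?P z) ^ n) sums G (1 / ?P z)"
    using power_series_sums_on_ball \<eta>(1) near0 by blast
  then have "(\<lambda>n. c (Suc n) * (1 / ?P z) ^ Suc n) sums f2 z"
    using sums_Suc_iff[of "\<lambda>n. c n * (1 / ?P z) ^ n" "f2 z"] nz g(2) by (simp add: c_def G_def)
  moreover have "singular_term f \<gamma> z1 z2 z n = c (Suc n) * (1 / ?P z) ^ Suc n" for n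
    using singular_term_eq[OF U assms(3) \<gamma>(1,4) assms(5)] by (simp add: c_def C_def p_def power_one_over)
  then have "singular_term f \<gamma> z1 z2 z = (\<lambda>n. c (Suc n) * (1 / ?P z) ^ Suc n)"
    by (rule ext)
  ultimately show ?thesis
    by (simp only:)
qed

lemma regular_term_loop_independent:
  assumes "open \<Omega>" "closed \<Omega>\<^sub>0" "f holomorphic_on \<Omega> - \<Omega>\<^sub>0" "z1 \<in> \<Omega>\<^sub>0" "z2 \<in> \<Omega>\<^sub>0"
    and "admissible_loop \<Omega> \<Omega>\<^sub>0 \<gamma>" "admissible_loop \<Omega> \<Omega>\<^sub>0 \<eta>"
  shows "regular_term f \<gamma> z1 z2 z = regular_term f \<eta> z1 z2 z"
proof -
  have "coeff_b f \<gamma> n x y = coeff_b f \<eta> n x y" if "x \<in> \<Omega>\<^sub>0" "y \<in> \<Omega>\<^sub>0" for n x y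
  proof -
    have h: "(\<lambda>w. f w / ((w - x) ^ n * (w - y) ^ (n + 1))) holomorphic_on \<Omega> - \<Omega>\<^sub>0"
      using assms(3) that by (intro holomorphic_intros) auto
    show ?thesis
      unfolding coeff_b_def admissible_loops_contour_integral_eq[OF assms(1,2) h assms(6,7)] ..
  qed
  then show ?thesis
    using assms(4,5) by (simp add: regular_term_def fun_eq_iff)
qed

lemma singular_term_loop_independent:
  assumes "open \<Omega>" "closed \<Omega>\<^sub>0" "f holomorphic_on \<Omega> - \<Omega>\<^sub>0"
    and "admissible_loop \<Omega> \<Omega>\<^sub>0 \<gamma>" "admissible_loop \<Omega> \<Omega>\<^sub>0 \<eta>"
  shows "singular_term f \<gamma> z1 z2 z = singular_term f \<eta> z1 z2 z"
proof -
  have "coeff_c f \<gamma> n x y = coeff_c f \<eta> n x y" for n x y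
  proof -
    have h: "(\<lambda>w. (w - x) ^ (n + 1) * (w - y) ^ n * f w) holomorphic_on \<Omega> - \<Omega>\<^sub>0"
      using assms(3) by (intro holomorphic_intros)
    show ?thesis
      unfolding coeff_c_def admissible_loops_contour_integral_eq[OF assms(1,2) h assms(4,5)] ..
  qed
  then show ?thesis
    by (simp add: singular_term_def fun_eq_iff)
qed

lemma cassini_annulusE:
  assumes "z \<in> cassini_annulus \<Omega> \<Omega>\<^sub>0 z1 z2" "z1 \<in> \<Omega>\<^sub>0"
  obtains \<rho> r where "\<rho> > 0" "\<rho> < norm (cassini z1 z2 z)" "norm (cassini z1 z2 z) < r"
    "\<And>w. \<rho> < norm (cassini z1 z2 w) \<Longrightarrow> w \<notin> \<Omega>\<^sub>0" "\<And>w. norm (cassini z1 z2 w) < r \<Longrightarrow> w \<in> \<Omega>"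
proof -
  have z: "inner_radius \<Omega>\<^sub>0 z1 z2 < ereal (norm (cassini z1 z2 z))"
    "ereal (norm (cassini z1 z2 z)) < outer_radius \<Omega> z1 z2"
    using assms(1) by (auto simp: cassini_annulus_def cassini_def)
  obtain \<rho> where \<rho>: "inner_radius \<Omega>\<^sub>0 z1 z2 < ereal \<rho>" "\<rho> < norm (cassini z1 z2 z)"
    using ereal_dense2[OF z(1)] by auto
  obtain r where r: "norm (cassini z1 z2 z) < r" "ereal r < outer_radius \<Omega> z1 z2"
    using ereal_dense2[OF z(2)] by auto
  have inner: "norm (cassini z1 z2 w) < \<rho>" if "w \<in> \<Omega>\<^sub>0" for w
  proof -
    have "ereal (norm (cassini z1 z2 w)) \<le> inner_radius \<Omega>\<^sub>0 z1 z2"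
      unfolding inner_radius_def cassini_def using that by (rule SUP_upper)
    then show ?thesis
      using \<rho>(1) le_less_trans by fastforce
  qed
  have outer: "r < norm (cassini z1 z2 w)" if "w \<notin> \<Omega>" for w
  proof -
    have "outer_radius \<Omega> z1 z2 \<le> ereal (norm (cassini z1 z2 w))"
      unfolding outer_radius_def cassini_def using that by (intro INF_lower) auto
    then show ?thesis
      using r(2) less_le_trans by fastforce
  qed
  have "\<rho> > 0"
    using inner[OF assms(2)] by (simp add: cassini_def)
  then show ?thesis
    using that \<rho>(2) r(1) inner outer by (meson less_asym)
qed

text \<open>
  This is stated for all points of the annulus, including those for which there are no loops that
  separate the point from \<open>\<Omega>\<^sub>0\<close> as the remainder formula demands.
\<close>

theorem two_point_laurent_series:
  assumes "open \<Omega>" "closed \<Omega>\<^sub>0" "f holomorphic_on \<Omega> - \<Omega>\<^sub>0" "admissible_loop \<Omega> \<Omega>\<^sub>0 \<gamma>"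
    and "z1 \<in> \<Omega>\<^sub>0" "z2 \<in> \<Omega>\<^sub>0" "z1 \<noteq> z2" "z \<in> cassini_annulus \<Omega> \<Omega>\<^sub>0 z1 z2"
  shows "summable (regular_term f \<gamma> z1 z2 z)" "summable (singular_term f \<gamma> z1 z2 z)"
    "f z = (\<Sum>n. regular_term f \<gamma> z1 z2 z n) + (\<Sum>n. singular_term f \<gamma> z1 z2 z n)"
proof -
  obtain f1 f2 where f12: "f1 holomorphic_on \<Omega>" "f2 holomorphic_on - \<Omega>\<^sub>0"
    "\<And>z. z \<in> \<Omega> - \<Omega>\<^sub>0 \<Longrightarrow> f z = f1 z + f2 z"
    "\<And>z. z \<in> inside (path_image \<gamma>) \<Longrightarrow> f1 z = cauchy_transform \<gamma> f z"
    "\<And>z. z \<in> outside (path_image \<gamma>) \<Longrightarrow> f2 z = - cauchy_transform \<gamma> f z"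
    by (rule laurent_splitting[OF assms(1-4)]) blast
  obtain \<rho> r where rr: "\<rho> > 0" "\<rho> < norm (cassini z1 z2 z)" "norm (cassini z1 z2 z) < r"
    "\<And>w. \<rho> < norm (cassini z1 z2 w) \<Longrightarrow> w \<notin> \<Omega>\<^sub>0" "\<And>w. norm (cassini z1 z2 w) < r \<Longrightarrow> w \<in> \<Omega>"
    by (rule cassini_annulusE[OF assms(8,5)]) blast
  have "regular_term f \<gamma> z1 z2 z sums f1 z"
    by (rule regular_series_sums[OF assms(1-7) f12(1), where r = r]) (use f12(4) rr in blast)+
  moreover have "singular_term f \<gamma> z1 z2 z sums f2 z"
    by (rule singular_series_sums[OF assms(1-4,7) f12(2), where \<rho> = \<rho>]) (use f12(5) rr in blast)+
  moreover have "z \<in> \<Omega> - \<Omega>\<^sub>0"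
    using assms(8) by (simp add: cassini_annulus_def)
  ultimately show "summable (regular_term f \<gamma> z1 z2 z)" "summable (singular_term f \<gamma> z1 z2 z)"
    "f z = (\<Sum>n. regular_term f \<gamma> z1 z2 z n) + (\<Sum>n. singular_term f \<gamma> z1 z2 z n)"
    using f12(3) by (auto simp: sums_iff)
qed

lemma two_point_laurent_finite:
  assumes "open \<Omega>" "closed \<Omega>\<^sub>0" "f holomorphic_on \<Omega> - \<Omega>\<^sub>0"
    and "z1 \<in> \<Omega>\<^sub>0" "z2 \<in> \<Omega>\<^sub>0" "z1 \<noteq> z2" "z \<in> \<Omega> - \<Omega>\<^sub>0" "remainder_loops \<Omega> \<Omega>\<^sub>0 z \<Gamma>1 \<Gamma>2"
  shows "f z = (\<Sum>n<N. regular_term f \<Gamma>1 z1 z2 z n) + (\<Sum>n<N. singular_term f \<Gamma>2 z1 z2 z n) +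
    remainder f \<Gamma>1 \<Gamma>2 N z1 z2 z"
proof -
  have loops: "admissible_loop \<Omega> \<Omega>\<^sub>0 \<Gamma>1" "admissible_loop \<Omega> \<Omega>\<^sub>0 \<Gamma>2"
    using assms(8) by (auto simp: remainder_loops_def)
  note \<Gamma>1 = admissible_loopD[OF loops(1)]
  note \<Gamma>2 = admissible_loopD[OF loops(2)]
  have U: "open (\<Omega> - \<Omega>\<^sub>0)"
    using assms by blast
  have "z \<in> inside (path_image \<Gamma>1)"
    using assms(8) by (simp add: remainder_loops_def)
  moreover from this have "z \<notin> path_image \<Gamma>1"
    using inside_no_overlap by blast
  ultimately have z_in: "z \<in> inside (path_image \<Gamma>1)" "z \<notin> path_image \<Gamma>1" .
  have z_out: "z \<in> outside (path_image \<Gamma>2)" "z \<notin> path_image \<Gamma>2"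
    using assms(8) \<Gamma>2(11) by (auto simp: remainder_loops_def)
  show ?thesis
  proof (induction N)
    case 0
    have "remainder f \<Gamma>1 \<Gamma>2 0 z1 z2 z = f z"
      using admissible_loops_contour_integral_eq[OF assms(1,2) _ loops]
      by (intro remainder_0[OF U assms(3) \<Gamma>1(1) \<Gamma>2(1) assms(7) \<Gamma>1(4) \<Gamma>2(4) z_in(2) z_out(2)
            \<Gamma>1(9)[OF z_in(1)] \<Gamma>2(10)[OF z_out(1)]])
    then show ?case
      by simp
  next
    case (Suc N)
    have "remainder f \<Gamma>1 \<Gamma>2 N z1 z2 z =
      regular_term f \<Gamma>1 z1 z2 z N + singular_term f \<Gamma>2 z1 z2 z N + remainder f \<Gamma>1 \<Gamma>2 (Suc N) z1 z2 z"
      using \<Gamma>1(1,4) \<Gamma>2(1,4) z_in(2) z_out(2) assms(3-7) U by (intro remainder_Suc[OF U]) auto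
    then show ?case
      using Suc by (simp add: algebra_simps)
  qed
qed

theorem theorem2:
  fixes \<Omega> \<Omega>\<^sub>0 :: "complex set" and f :: "complex \<Rightarrow> complex" and z1 z2 :: complex
    and \<gamma>1 \<gamma>2 :: "real \<Rightarrow> complex"
  assumes "\<Omega>\<^sub>0 \<subseteq> \<Omega>" and "closed \<Omega>\<^sub>0" and "open \<Omega>"
    and "f analytic_on (\<Omega> - \<Omega>\<^sub>0)"
    and "z1 \<in> \<Omega>\<^sub>0" and "z2 \<in> \<Omega>\<^sub>0" and "z1 \<noteq> z2"
    and "admissible_loop \<Omega> \<Omega>\<^sub>0 \<gamma>1" and "admissible_loop \<Omega> \<Omega>\<^sub>0 \<gamma>2"
  shows "(\<forall>z \<in> \<Omega> - \<Omega>\<^sub>0. \<forall>\<Gamma>1 \<Gamma>2. remainder_loops \<Omega> \<Omega>\<^sub>0 z \<Gamma>1 \<Gamma>2 \<longrightarrow>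
           (\<forall>N \<ge> 1. f z = (\<Sum>n<N. regular_term f \<gamma>1 z1 z2 z n)
                        + (\<Sum>n<N. singular_term f \<gamma>2 z1 z2 z n)
                        + remainder f \<Gamma>1 \<Gamma>2 N z1 z2 z)) \<and>
         (\<forall>z \<in> cassini_annulus \<Omega> \<Omega>\<^sub>0 z1 z2.
           (\<forall>\<Gamma>1 \<Gamma>2. remainder_loops \<Omega> \<Omega>\<^sub>0 z \<Gamma>1 \<Gamma>2 \<longrightarrow>
              (\<lambda>N. remainder f \<Gamma>1 \<Gamma>2 N z1 z2 z) \<longlonglongrightarrow> 0) \<and>
           summable (regular_term f \<gamma>1 z1 z2 z) \<and>
           summable (singular_term f \<gamma>2 z1 z2 z) \<and>
           f z = (\<Sum>n. regular_term f \<gamma>1 z1 z2 z n) + (\<Sum>n. singular_term f \<gamma>2 z1 z2 z n))"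
proof -
  have hol: "f holomorphic_on \<Omega> - \<Omega>\<^sub>0"
    using assms(4) analytic_imp_holomorphic by blast
  have finite_form: "f z = (\<Sum>n<N. regular_term f \<gamma>1 z1 z2 z n) + (\<Sum>n<N. singular_term f \<gamma>2 z1 z2 z n) +
      remainder f \<Gamma>1 \<Gamma>2 N z1 z2 z"
    if "z \<in> \<Omega> - \<Omega>\<^sub>0" "remainder_loops \<Omega> \<Omega>\<^sub>0 z \<Gamma>1 \<Gamma>2" for z \<Gamma>1 \<Gamma>2 N
  proof -
    have loops: "admissible_loop \<Omega> \<Omega>\<^sub>0 \<Gamma>1" "admissible_loop \<Omega> \<Omega>\<^sub>0 \<Gamma>2"
      using that(2) by (auto simp: remainder_loops_def)
    have "regular_term f \<gamma>1 z1 z2 z = regular_term f \<Gamma>1 z1 z2 z"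
      by (rule regular_term_loop_independent[OF assms(3,2) hol assms(5,6,8) loops(1)])
    moreover have "singular_term f \<gamma>2 z1 z2 z = singular_term f \<Gamma>2 z1 z2 z"
      by (rule singular_term_loop_independent[OF assms(3,2) hol assms(9) loops(2)])
    ultimately show ?thesis
      using two_point_laurent_finite[OF assms(3,2) hol assms(5-7) that] by simp
  qed
  have series: "summable (regular_term f \<gamma>1 z1 z2 z)" "summable (singular_term f \<gamma>2 z1 z2 z)"
    "f z = (\<Sum>n. regular_term f \<gamma>1 z1 z2 z n) + (\<Sum>n. singular_term f \<gamma>2 z1 z2 z n)"
    if "z \<in> cassini_annulus \<Omega> \<Omega>\<^sub>0 z1 z2" for z
    using two_point_laurent_series[OF assms(3,2) hol assms(8,5-7) that]
      singular_term_loop_independent[OF assms(3,2) hol assms(9,8)] by simp_all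
  have limit: "(\<lambda>N. remainder f \<Gamma>1 \<Gamma>2 N z1 z2 z) \<longlonglongrightarrow> 0"
    if z: "z \<in> cassini_annulus \<Omega> \<Omega>\<^sub>0 z1 z2" and loops: "remainder_loops \<Omega> \<Omega>\<^sub>0 z \<Gamma>1 \<Gamma>2" for z \<Gamma>1 \<Gamma>2
  proof -
    have "z \<in> \<Omega> - \<Omega>\<^sub>0"
      using z by (simp add: cassini_annulus_def)
    then have rem: "remainder f \<Gamma>1 \<Gamma>2 N z1 z2 z =
        f z - ((\<Sum>n<N. regular_term f \<gamma>1 z1 z2 z n) + (\<Sum>n<N. singular_term f \<gamma>2 z1 z2 z n))" for N
      using finite_form[OF _ loops, of N] by (simp add: algebra_simps)
    have "(\<lambda>N. f z - ((\<Sum>n<N. regular_term f \<gamma>1 z1 z2 z n) + (\<Sum>n<N. singular_term f \<gamma>2 z1 z2 z n)))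
        \<longlonglongrightarrow> f z - ((\<Sum>n. regular_term f \<gamma>1 z1 z2 z n) + (\<Sum>n. singular_term f \<gamma>2 z1 z2 z n))"
      using series(1,2)[OF z] by (intro tendsto_intros summable_LIMSEQ)
    then show ?thesis
      unfolding rem using series(3)[OF z] by simp
  qed
  show ?thesis
    by (intro conjI ballI allI impI finite_form limit series)
qed

end
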